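(* Consider the online non-preemptive total flow-time minimization problem on unrelated machines with rejection. For any $\epsilon>0$, there exists an online algorithm that rejects at most a $2\epsilon$ fraction of the total number of jobs and is $2\left(\frac{1+\epsilon}{\epsilon}\right)^{2}$-competitive, i.e., on every instance the total flow-time $\sum_j (C_j-r_j)$ of the jobs it does not reject is at most $2\left(\frac{1+\epsilon}{\epsilon}\right)^{2}$ times the minimum total flow-time of an (offline) non-preemptive schedule of all jobs.
   Context: Problem: there is a set $\mathcal{M}$ of unrelated machines. Jobs arrive online; each job $j$ has a release time $r_j$ and a processing time $p_{ij}$ on each machine $i\in\mathcal{M}$, all of which become known only at time $r_j$. A job is successfully executed only if it runs on some machine $i$ for $p_{ij}$ consecutive time units (non-preemptively), starting no earlier than $r_j$; each machine processes at most one job at a time. The completion time of $j$ is $C_j$ and its flow-time is $F_j=C_j-r_j$. In the rejection model, the online algorithm may reject (not complete) some jobs; it is allowed to reject at most the stated fraction of jobs, and its cost is measured on the non-rejected jobs, compared against an optimal offline schedule that must complete all jobs. *)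

theory Defs
  imports Complex_Main
begin

type_synonym machine = nat
type_synonym job = nat

record sched_instance =
  machines :: "machine set"
  jobs :: "job set"
  release :: "job \<Rightarrow> real"
  ptime :: "machine \<Rightarrow> job \<Rightarrow> real"

definition valid_instance :: "sched_instance \<Rightarrow> bool" where
  "valid_instance I \<longleftrightarrow>
     finite (machines I) \<and> machines I \<noteq> {} \<and> finite (jobs I) \<and>
     (\<forall>j\<in>jobs I. 0 \<le> release I j \<and> (\<forall>i\<in>machines I. 0 < ptime I i j))"

text \<open>A run occupies its machine during the half-open interval from \<open>start\<close> to \<open>stop\<close>.\<close>

datatype run = Run (mach: machine) (start: real) (stop: real)

text \<open>Each job is run at most once: \<open>None\<close> means never started, and a run that stops before
  the full processing time has elapsed is an interrupted one. Both count as rejections; the time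
  spent on an interrupted job still blocks the machine.\<close>

type_synonym schedule = "job \<Rightarrow> run option"

definition feasible :: "sched_instance \<Rightarrow> schedule \<Rightarrow> bool" where
  "feasible I S \<longleftrightarrow>
     (\<forall>j\<in>jobs I. \<forall>x. S j = Some x \<longrightarrow>
        mach x \<in> machines I \<and> release I j \<le> start x \<and>
        start x \<le> stop x \<and> stop x \<le> start x + ptime I (mach x) j) \<and>
     (\<forall>j\<in>jobs I. \<forall>k\<in>jobs I. \<forall>x y. j \<noteq> k \<longrightarrow> S j = Some x \<longrightarrow> S k = Some y \<longrightarrow>
        mach x = mach y \<longrightarrow> {start x..<stop x} \<inter> {start y..<stop y} = {})"

definition completed :: "sched_instance \<Rightarrow> schedule \<Rightarrow> job set" where
  "completed I S =
     {j \<in> jobs I. \<exists>x. S j = Some x \<and> stop x = start x + ptime I (mach x) j}"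

definition rejected :: "sched_instance \<Rightarrow> schedule \<Rightarrow> job set" where
  "rejected I S = jobs I - completed I S"

definition total_flow_time :: "sched_instance \<Rightarrow> schedule \<Rightarrow> real" where
  "total_flow_time I S = (\<Sum>j\<in>completed I S. stop (the (S j)) - release I j)"

definition offline_schedules :: "sched_instance \<Rightarrow> schedule set" where
  "offline_schedules I = {S. feasible I S \<and> rejected I S = {}}"

text \<open>For a valid instance this infimum ranges over a nonempty set of nonnegative reals (shown
  below). It is a minimum, since for each of the finitely many choices of an assignment and
  an order of the jobs on every machine, starting each job as early as possible is best.\<close>

definition opt_flow_time :: "sched_instance \<Rightarrow> real" where
  "opt_flow_time I = Inf (total_flow_time I ` offline_schedules I)"

definition known_jobs :: "sched_instance \<Rightarrow> real \<Rightarrow> job set" where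
  "known_jobs I t = {j \<in> jobs I. release I j \<le> t}"

definition agree_until :: "real \<Rightarrow> sched_instance \<Rightarrow> sched_instance \<Rightarrow> bool" where
  "agree_until t I I' \<longleftrightarrow>
     machines I = machines I' \<and> known_jobs I t = known_jobs I' t \<and>
     (\<forall>j\<in>known_jobs I t. release I j = release I' j \<and>
        (\<forall>i\<in>machines I. ptime I i j = ptime I' i j))"

text \<open>What has happened to a job up to and including time \<open>t\<close>: not started, or started
  on a machine at some time and either still running (inner \<open>None\<close>) or already stopped.\<close>

definition history :: "real \<Rightarrow> schedule \<Rightarrow> job \<Rightarrow> (machine \<times> real \<times> real option) option" where
  "history t S j =
     (case S j of
        None \<Rightarrow> None
      | Some x \<Rightarrow>
          if start x \<le> t
          then Some (mach x, start x, if stop x \<le> t then Some (stop x) else None)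
          else None)"

text \<open>Being online is non-anticipation: everything done up to time \<open>t\<close> is determined by the
  machines and the data of the jobs released up to time \<open>t\<close>. The number of jobs still to
  come is not known either, as the two instances may differ arbitrarily after \<open>t\<close>.\<close>

definition online_algorithm :: "(sched_instance \<Rightarrow> schedule) \<Rightarrow> bool" where
  "online_algorithm A \<longleftrightarrow>
     (\<forall>I. valid_instance I \<longrightarrow> feasible I (A I)) \<and>
     (\<forall>I I' t. valid_instance I \<longrightarrow> valid_instance I' \<longrightarrow> agree_until t I I' \<longrightarrow>
        (\<forall>j\<in>known_jobs I t. history t (A I) j = history t (A I') j))"

lemma total_flow_time_nonneg:
  assumes "valid_instance I" "feasible I S"
  shows "0 \<le> total_flow_time I S"
  unfolding total_flow_time_def
proof (rule sum_nonneg)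
  fix j assume "j \<in> completed I S"
  then obtain x where "j \<in> jobs I" "S j = Some x"
    by (auto simp: completed_def)
  with assms(2) have "release I j \<le> start x" "start x \<le> stop x"
    by (auto simp: feasible_def)
  with \<open>S j = Some x\<close> show "0 \<le> stop (the (S j)) - release I j" by simp
qed

lemma bdd_below_offline:
  assumes "valid_instance I"
  shows "bdd_below (total_flow_time I ` offline_schedules I)"
  using total_flow_time_nonneg[OF assms]
  by (intro bdd_belowI[of _ 0]) (auto simp: offline_schedules_def)

lemma offline_schedules_nonempty:
  assumes "valid_instance I"
  shows "offline_schedules I \<noteq> {}"
proof -
  obtain i where i: "i \<in> machines I"
    using assms by (auto simp: valid_instance_def)
  have fin: "finite (jobs I)" and pos: "\<And>j. j \<in> jobs I \<Longrightarrow> 0 < ptime I i j"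
    and rel: "\<And>j. j \<in> jobs I \<Longrightarrow> 0 \<le> release I j"
    using assms i by (auto simp: valid_instance_def)
  define s where "s j = (\<Sum>k\<in>jobs I. release I k) + (\<Sum>k\<in>{k \<in> jobs I. k < j}. ptime I i k)" for j
  define S where "S j = Some (Run i (s j) (s j + ptime I i j))" for j
  have rs: "release I j \<le> s j" if "j \<in> jobs I" for j
  proof -
    have "release I j \<le> (\<Sum>k\<in>jobs I. release I k)"
      using member_le_sum[of j "jobs I" "release I"] that fin rel by auto
    moreover have "0 \<le> (\<Sum>k\<in>{k \<in> jobs I. k < j}. ptime I i k)"
      by (rule sum_nonneg) (auto intro: less_imp_le pos)
    ultimately show ?thesis by (simp add: s_def)
  qed
  have step: "s j + ptime I i j \<le> s k" if "j \<in> jobs I" "j < k" for j k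
  proof -
    have "(\<Sum>l\<in>insert j {l \<in> jobs I. l < j}. ptime I i l) \<le> (\<Sum>l\<in>{l \<in> jobs I. l < k}. ptime I i l)"
      using that fin by (intro sum_mono2) (auto intro: less_imp_le pos)
    with fin show ?thesis by (simp add: s_def)
  qed
  have disj: "{s j..<s j + ptime I i j} \<inter> {s k..<s k + ptime I i k} = {}"
    if "j \<in> jobs I" "k \<in> jobs I" "j \<noteq> k" for j k
    using that step[of j k] step[of k j] by (cases "j < k") auto
  have "feasible I S"
    unfolding feasible_def
  proof (intro conjI ballI allI impI)
    fix j x assume "j \<in> jobs I" "S j = Some x"
    then show "mach x \<in> machines I" "release I j \<le> start x" "start x \<le> stop x"
      "stop x \<le> start x + ptime I (mach x) j"
      using i rs[of j] pos[of j] by (auto simp: S_def)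
  next
    fix j k x y assume "j \<in> jobs I" "k \<in> jobs I" "j \<noteq> k" "S j = Some x" "S k = Some y"
    then show "{start x..<stop x} \<inter> {start y..<stop y} = {}"
      using disj[of j k] by (auto simp: S_def simp del: Int_atLeastLessThan)
  qed
  moreover have "rejected I S = {}"
    by (auto simp: rejected_def completed_def S_def)
  ultimately show ?thesis by (auto simp: offline_schedules_def)
qed

end

theory Submission
  imports Defs "HOL-Analysis.Lebesgue_Measure"
begin

text \<open>Let \<open>m\<close> be \<open>1 / \<epsilon>\<close> rounded up. Every machine serves its queue shortest job first. A job \<open>j\<close> is
  dispatched on arrival to the machine \<open>i\<close> minimising \<open>m p\<^sub>i\<^sub>j + (\<Sum>l. min p\<^sub>i\<^sub>l p\<^sub>i\<^sub>j)\<close>, the sum ranging over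
  the queue of \<open>i\<close>. A running job is interrupted at the \<open>m\<close>-th dispatch during its run, and every
  \<open>m\<close>-th dispatch to a machine drops the longest job of its queue; each rule rejects at most
  one job in \<open>m\<close>.

  Each job carries a virtual completion time that later arrivals only increase: it is the time at
  which the job would complete without further arrivals, except that interruptions do not
  decrease it and that it is frozen when the job is dropped. The total virtual flow time
  \<open>\<Phi>\<close> bounds the flow time of the algorithm and is bounded by the sum of the dispatching costs. By
  minimality, each cost is at most the cost on the machine used by an offline schedule; this is
  charged to the flow time of the job there and to the virtual presence of other jobs during its
  run. Dropped jobs are virtually present without contributing to any cost, so only a fraction
  \<open>1 - 1 / m\<close> of the virtual presence is charged. As the runs on a machine are disjoint, this gives
  \<open>\<Phi> / m \<le> (m + 2 - 1 / m) OPT\<close>, and \<open>m\<^sup>2 + 2 m - 1 \<le> 2 m\<^sup>2 \<le> 2 ((1 + \<epsilon>) / \<epsilon>)\<^sup>2\<close>.\<close>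

subsection \<open>One machine\<close>

text \<open>The machine is advanced only when a job is dispatched to it, and \<open>free\<close> is the end of the last
  run started so far. The field \<open>hits\<close> counts the dispatches during the current run, and \<open>ticks\<close>
  those since a job was last dropped. The fields \<open>interrupted\<close>, \<open>dropped\<close> and \<open>virt\<close> (the
  virtual completion time) serve the analysis only and do not influence the schedule.\<close>

record mstate =
  assigned :: "job set"
  queue :: "job list"
  free :: real
  current :: "job option"
  hits :: nat
  ticks :: nat
  timing :: "job \<Rightarrow> (real \<times> real) option"
  interrupted :: "job set"
  dropped :: "job set"
  virt :: "job \<Rightarrow> real"

definition idle :: mstate where
  "idle = \<lparr>assigned = {}, queue = [], free = 0, current = None, hits = 0, ticks = 0,
     timing = (\<lambda>_. None), interrupted = {}, dropped = {}, virt = (\<lambda>_. 0)\<rparr>"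

definition launch :: "(job \<Rightarrow> real) \<Rightarrow> job \<Rightarrow> job list \<Rightarrow> mstate \<Rightarrow> mstate" where
  "launch p h q s = s\<lparr>queue := q, free := free s + p h, current := Some h, hits := 0,
     timing := (timing s)(h \<mapsto> (free s, free s + p h))\<rparr>"

primrec launches :: "(job \<Rightarrow> real) \<Rightarrow> (real \<Rightarrow> bool) \<Rightarrow> job list \<Rightarrow> mstate \<Rightarrow> mstate" where
  "launches p P [] s = s"
| "launches p P (h # q) s = (if P (free s) then launches p P q (launch p h q s) else s)"

definition advance :: "(job \<Rightarrow> real) \<Rightarrow> (real \<Rightarrow> bool) \<Rightarrow> mstate \<Rightarrow> mstate" where
  "advance p P s = launches p P (queue s) s"

abbreviation drain :: "(job \<Rightarrow> real) \<Rightarrow> mstate \<Rightarrow> mstate" where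
  "drain p \<equiv> advance p (\<lambda>_. True)"

definition contend :: "nat \<Rightarrow> real \<Rightarrow> mstate \<Rightarrow> mstate" where
  "contend m t s =
     (if free s \<le> t then s\<lparr>free := t\<rparr>
      else if Suc (hits s) < m then s\<lparr>hits := Suc (hits s)\<rparr>
      else let k = the (current s) in
        s\<lparr>free := t, current := None, hits := 0,
          timing := (timing s)(k \<mapsto> (fst (the (timing s k)), t)),
          interrupted := insert k (interrupted s)\<rparr>)"

definition enqueue :: "(job \<Rightarrow> real) \<Rightarrow> job \<Rightarrow> mstate \<Rightarrow> mstate" where
  "enqueue p j s = s\<lparr>assigned := insert j (assigned s), queue := insort_key p j (queue s),
     ticks := Suc (ticks s),
     virt := (\<lambda>l. if l = j then free s + p j + (\<Sum>x\<in>{x \<in> set (queue s). p x < p j}. p x)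
                  else if l \<in> set (queue s) \<and> p j \<le> p l then virt s l + p j
                  else virt s l)\<rparr>"

definition shed :: "nat \<Rightarrow> mstate \<Rightarrow> mstate" where
  "shed m s = (if ticks s < m then s
     else s\<lparr>queue := butlast (queue s), dropped := insert (last (queue s)) (dropped s),
       ticks := 0\<rparr>)"

definition admit :: "nat \<Rightarrow> (job \<Rightarrow> real) \<Rightarrow> real \<Rightarrow> job \<Rightarrow> mstate \<Rightarrow> mstate" where
  "admit m p t j s = shed m (enqueue p j (contend m t (advance p (\<lambda>x. x < t) s)))"

definition cost :: "nat \<Rightarrow> (job \<Rightarrow> real) \<Rightarrow> real \<Rightarrow> job \<Rightarrow> mstate \<Rightarrow> real" where
  "cost m p t j s = real m * p j +
     (\<Sum>l\<in>set (queue (advance p (\<lambda>x. x < t) s)). min (p l) (p j))"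

text \<open>With the queue served in order from time \<open>f\<close>, \<open>late\<close> counts the jobs that complete after \<open>T\<close>, and
  \<open>covered\<close> says that each job completes by its time in \<open>c\<close>.\<close>

fun late :: "(job \<Rightarrow> real) \<Rightarrow> real \<Rightarrow> job list \<Rightarrow> real \<Rightarrow> nat" where
  "late p f [] T = 0"
| "late p f (x # xs) T = (if T < f + p x then 1 else 0) + late p (f + p x) xs T"

fun covered :: "(job \<Rightarrow> real) \<Rightarrow> (job \<Rightarrow> real) \<Rightarrow> real \<Rightarrow> job list \<Rightarrow> bool" where
  "covered p c f [] = True"
| "covered p c f (x # xs) = (f + p x \<le> c x \<and> covered p c (f + p x) xs)"

section \<open>Completion times of a list of jobs served in order\<close>

lemma late_mono: "f \<le> g \<Longrightarrow> late p f xs T \<le> late p g xs T"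
proof (induction xs arbitrary: f g)
  case (Cons x xs)
  then have "late p (f + p x) xs T \<le> late p (g + p x) xs T" by simp
  with Cons.prems show ?case by auto
qed simp

text \<open>As \<open>x\<close> is shortest, the k-th completion time of \<open>x # xs\<close> is at
  most the k-th one of \<open>xs\<close>, so only the last position can add a late job.\<close>

lemma late_Cons_le:
  "sorted (map p (x # xs)) \<Longrightarrow> late p f (x # xs) T \<le> late p f xs T + 1"
proof (induction xs arbitrary: x f)
  case (Cons y ys)
  have "late p (f + p x) (y # ys) T \<le> late p (f + p x) ys T + 1"
    using Cons by (auto simp del: late.simps)
  moreover have "late p (f + p x) ys T \<le> late p (f + p y) ys T"
    using Cons.prems by (intro late_mono) simp
  moreover have "f + p x \<le> f + p y" using Cons.prems by simp
  ultimately show ?case by (auto simp del: late.simps simp: late.simps(2)[of p f])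
qed simp

lemma late_insort_le:
  "sorted (map p xs) \<Longrightarrow> late p f (insort_key p j xs) T \<le> late p f xs T + 1"
proof (induction xs arbitrary: f)
  case (Cons x xs)
  show ?case
  proof (cases "p j \<le> p x")
    case True
    have "sorted (map p (j # x # xs))" using Cons.prems True by auto
    from late_Cons_le[OF this, of f T] True show ?thesis by (simp del: late.simps)
  next
    case False
    then show ?thesis using Cons.IH[of "f + p x"] Cons.prems by simp
  qed
qed simp

lemma late_eq_0:
  "f + (\<Sum>x\<leftarrow>xs. p x) \<le> T \<Longrightarrow> \<forall>x\<in>set xs. 0 \<le> p x \<Longrightarrow> late p f xs T = 0"
proof (induction xs arbitrary: f)
  case (Cons x xs)
  have "0 \<le> (\<Sum>x\<leftarrow>xs. p x)" using Cons.prems by (intro sum_list_nonneg) auto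
  with Cons show ?case by (auto simp: algebra_simps)
qed simp

lemma late_snoc:
  "late p f (xs @ [x]) T = late p f xs T + (if T < f + (\<Sum>x\<leftarrow>xs. p x) + p x then 1 else 0)"
  by (induction xs arbitrary: f) (auto simp: algebra_simps)

text \<open>Jobs completing by \<open>T\<close> fit between \<open>f\<close> and \<open>T\<close>; each of the others contributes at most \<open>w\<close>.\<close>

lemma sum_min_le_late:
  "0 \<le> w \<Longrightarrow> \<forall>x\<in>set xs. 0 \<le> p x \<Longrightarrow>
   (\<Sum>x\<leftarrow>xs. min (p x) w) \<le> max 0 (T - f) + w * real (late p f xs T)"
proof (induction xs arbitrary: f)
  case (Cons x xs)
  have "0 \<le> p x" using Cons.prems by simp
  with Cons.IH[of "f + p x"] Cons.prems show ?case
    by (cases "T < f + p x") (auto simp: algebra_simps max_def min_def split: if_splits)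
qed simp

text \<open>Used with \<open>d = p j\<close> for the jobs behind a newly inserted one, and with
  \<open>d = 0\<close> when an interruption lets the queue start earlier.\<close>

lemma covered_shift:
  "covered p c f xs \<Longrightarrow> \<forall>x\<in>set xs. c x + d \<le> c' x \<Longrightarrow> g \<le> f + d \<Longrightarrow> covered p c' g xs"
proof (induction xs arbitrary: f g)
  case (Cons x xs)
  have "covered p c' (g + p x) xs" using Cons by (intro Cons.IH[of "f + p x"]) auto
  with Cons.prems show ?case by auto
qed simp

text \<open>The new job overtakes every job that is at least as long, ties included: those must
  allow \<open>p j\<close> more, while the new job waits for the strictly shorter ones only. This
  matches the update of \<open>virt\<close> in \<open>enqueue\<close>.\<close>

lemma covered_insort:
  assumes "covered p c f xs" "sorted (map p xs)"
    "\<forall>x\<in>set xs. c x \<le> c' x \<and> (p j \<le> p x \<longrightarrow> c x + p j \<le> c' x)"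
    "f + p j + (\<Sum>x\<leftarrow>filter (\<lambda>x. p x < p j) xs. p x) \<le> c' j"
  shows "covered p c' f (insort_key p j xs)"
  using assms
proof (induction xs arbitrary: f)
  case (Cons x xs)
  show ?case
  proof (cases "p j \<le> p x")
    case True
    then have ge: "\<forall>y\<in>set (x # xs). p j \<le> p y" using Cons.prems(2) by auto
    then have "filter (\<lambda>y. p y < p j) (x # xs) = []" by (simp only: filter_empty_conv) force
    with Cons.prems(4) have "f + p j \<le> c' j" by simp
    moreover have "covered p c' (f + p j) (x # xs)"
      using Cons.prems ge by (intro covered_shift[OF Cons.prems(1), of "p j"]) auto
    ultimately show ?thesis using True by simp
  next
    case False
    have "covered p c' (f + p x) (insort_key p j xs)"
      using Cons.prems False by (intro Cons.IH) (auto simp: algebra_simps)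
    with False Cons.prems show ?thesis by force
  qed
qed simp

text \<open>A job that completes after \<open>T\<close> has a \<open>c\<close>-value beyond
  \<open>T\<close>; distinctness turns the count of positions into a count of jobs.\<close>

lemma covered_late:
  "covered p c f xs \<Longrightarrow> distinct xs \<Longrightarrow> late p f xs T \<le> card {x \<in> set xs. T < c x}"
proof (induction xs arbitrary: f)
  case (Cons x xs)
  have eq: "{y \<in> set (x # xs). T < c y} =
      (if T < c x then insert x {y \<in> set xs. T < c y} else {y \<in> set xs. T < c y})"
    by auto
  have "late p (f + p x) xs T \<le> card {y \<in> set xs. T < c y}" using Cons by auto
  with Cons.prems show ?case unfolding eq by auto
qed simp

lemma covered_snoc:
  "covered p c f (xs @ [x]) \<longleftrightarrow> covered p c f xs \<and> f + (\<Sum>x\<leftarrow>xs. p x) + p x \<le> c x"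
  by (induction xs arbitrary: f) (auto simp: algebra_simps)

section \<open>Launching waiting jobs\<close>

lemma advance_invariant:
  assumes "Q s" "\<And>s h q. Q s \<Longrightarrow> queue s = h # q \<Longrightarrow> P (free s) \<Longrightarrow> Q (launch p h q s)"
  shows "Q (advance p P s)"
proof -
  have "Q s \<Longrightarrow> queue s = q \<Longrightarrow> Q (launches p P q s)" for q s
  proof (induction q arbitrary: s)
    case (Cons h q)
    then have "P (free s) \<Longrightarrow> Q (launches p P q (launch p h q s))"
      by (intro Cons.IH assms(2)) (auto simp: launch_def)
    with Cons.prems show ?case by simp
  qed simp
  with assms(1) show ?thesis by (auto simp: advance_def)
qed

text \<open>Launching stops early only when \<open>P\<close> fails. Hence after advancing to
  \<open>t\<close> a waiting job implies \<open>t \<le> free\<close>, and draining leaves an empty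
  queue.\<close>

lemma queue_advance:
  "queue (advance p P s) \<noteq> [] \<Longrightarrow> \<not> P (free (advance p P s))"
proof -
  have "queue s = q \<Longrightarrow> queue (launches p P q s) \<noteq> [] \<Longrightarrow> \<not> P (free (launches p P q s))" for q s
    by (induction q arbitrary: s) (auto simp: launch_def)
  then show "queue (advance p P s) \<noteq> [] \<Longrightarrow> \<not> P (free (advance p P s))"
    by (auto simp: advance_def)
qed

text \<open>\<open>advance\<close> performs an initial segment of the launches of
  \<open>drain\<close>.\<close>

lemma drain_advance: "drain p (advance p P s) = drain p s"
proof -
  have "queue s = q \<Longrightarrow> drain p (launches p P q s) = launches p (\<lambda>_. True) q s" for q s
    by (induction q arbitrary: s) (auto simp: launch_def advance_def)
  then show ?thesis by (simp add: advance_def)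
qed

lemma advance_fields [simp]:
  "assigned (advance p P s) = assigned s" "virt (advance p P s) = virt s"
  "ticks (advance p P s) = ticks s" "dropped (advance p P s) = dropped s"
  "interrupted (advance p P s) = interrupted s"
proof -
  define Q where "Q s' \<longleftrightarrow> assigned s' = assigned s \<and> virt s' = virt s \<and> ticks s' = ticks s \<and>
     dropped s' = dropped s \<and> interrupted s' = interrupted s" for s' :: mstate
  have "Q (advance p P s)"
    by (rule advance_invariant) (auto simp: Q_def launch_def)
  then show "assigned (advance p P s) = assigned s" "virt (advance p P s) = virt s"
    "ticks (advance p P s) = ticks s" "dropped (advance p P s) = dropped s"
    "interrupted (advance p P s) = interrupted s"
    by (auto simp: Q_def)
qed

lemma contend_fields [simp]:
  "assigned (contend m t s) = assigned s" "virt (contend m t s) = virt s"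
  "ticks (contend m t s) = ticks s" "dropped (contend m t s) = dropped s"
  "queue (contend m t s) = queue s"
  by (auto simp: contend_def Let_def)

lemma shed_fields [simp]:
  "assigned (shed m s) = assigned s" "virt (shed m s) = virt s" "free (shed m s) = free s"
  "current (shed m s) = current s" "hits (shed m s) = hits s" "timing (shed m s) = timing s"
  "interrupted (shed m s) = interrupted s"
  by (auto simp: shed_def)

lemma enqueue_fields [simp]:
  "assigned (enqueue p j s) = insert j (assigned s)" "free (enqueue p j s) = free s"
  "current (enqueue p j s) = current s" "hits (enqueue p j s) = hits s"
  "timing (enqueue p j s) = timing s" "interrupted (enqueue p j s) = interrupted s"
  "dropped (enqueue p j s) = dropped s" "ticks (enqueue p j s) = Suc (ticks s)"
  "queue (enqueue p j s) = insort_key p j (queue s)"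
  by (auto simp: enqueue_def)

lemma assigned_admit [simp]: "assigned (admit m p t j s) = insert j (assigned s)"
  by (simp add: admit_def)

text \<open>Here \<open>L\<close> is a time no earlier than the arrivals so far; assumption \<open>busy\<close> makes the job that
  an arrival at time \<open>L\<close> interrupts well defined.\<close>

locale consistent =
  fixes p r :: "job \<Rightarrow> real" and L :: real and s :: mstate
  assumes finite_assigned: "finite (assigned s)"
    and queue_sub: "set (queue s) \<subseteq> assigned s"
    and queue_distinct: "distinct (queue s)"
    and queue_sorted: "sorted (map p (queue s))"
    and queue_released: "l \<in> set (queue s) \<Longrightarrow> r l \<le> free s"
    and ptime_pos: "l \<in> assigned s \<Longrightarrow> 0 < p l"
    and released: "l \<in> assigned s \<Longrightarrow> r l \<le> L"
    and virt_ge: "l \<in> assigned s \<Longrightarrow> r l \<le> virt s l"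
    and timing_sub: "dom (timing s) \<subseteq> assigned s"
    and queue_timing: "set (queue s) \<inter> dom (timing s) = {}"
    and interrupted_sub: "interrupted s \<subseteq> dom (timing s)"
    and dropped_sub: "dropped s \<subseteq> assigned s"
    and dropped_disjoint: "dropped s \<inter> (set (queue s) \<union> dom (timing s)) = {}"
    and assigned_cases: "assigned s \<subseteq> set (queue s) \<union> dom (timing s) \<union> dropped s"
    and timing_bounds: "timing s l = Some (a, b) \<Longrightarrow>
      r l \<le> a \<and> a \<le> b \<and> b \<le> a + p l \<and> b \<le> free s \<and> b \<le> virt s l"
    and timing_full: "timing s l = Some (a, b) \<Longrightarrow> l \<notin> interrupted s \<Longrightarrow> b = a + p l"
    and timing_disjoint: "timing s k = Some (a, b) \<Longrightarrow> timing s l = Some (c, d) \<Longrightarrow> k \<noteq> l \<Longrightarrow>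
      b \<le> c \<or> d \<le> a"
    and current_sub: "current s = Some k \<Longrightarrow> k \<in> assigned s"
    and busy: "L < free s \<Longrightarrow> \<exists>k a. current s = Some k \<and> timing s k = Some (a, free s) \<and> a \<le> L \<and>
      k \<notin> interrupted s \<and> (\<forall>l b c. l \<noteq> k \<longrightarrow> timing s l = Some (b, c) \<longrightarrow> c \<le> a)"
    and virt_covers: "covered p (virt s) (free s) (queue s)"

section \<open>Preservation of \<open>consistent\<close>\<close>

lemma consistent_idle: "0 \<le> L \<Longrightarrow> consistent p r L idle"
  by unfold_locales (auto simp: idle_def)

lemma consistent_mono:
  assumes "consistent p r L s" "L \<le> L'"
  shows "consistent p r L' s"
proof -
  interpret consistent p r L s by fact
  show ?thesis
  proof unfold_locales
    assume "L' < free s"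
    with assms(2) have "L < free s" by simp
    from busy[OF this] assms(2)
    show "\<exists>k a. current s = Some k \<and> timing s k = Some (a, free s) \<and> a \<le> L' \<and>
      k \<notin> interrupted s \<and> (\<forall>l b c. l \<noteq> k \<longrightarrow> timing s l = Some (b, c) \<longrightarrow> c \<le> a)"
      by (meson order_trans)
  next
    show "l \<in> assigned s \<Longrightarrow> r l \<le> L'" for l using released[of l] assms(2) by simp
  qed (fact finite_assigned queue_sub queue_distinct queue_sorted queue_released ptime_pos
      virt_ge timing_sub queue_timing interrupted_sub dropped_sub dropped_disjoint assigned_cases
      timing_bounds timing_full timing_disjoint current_sub virt_covers)+
qed

text \<open>\<open>virt_covers\<close> at the head of the queue bounds the end of the new run by its
  virtual completion time, and \<open>free s \<le> L\<close> makes the run start early enough for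
  \<open>busy\<close>.\<close>

lemma consistent_launch:
  assumes "consistent p r L s" "queue s = h # q" "free s \<le> L"
  shows "consistent p r L (launch p h q s)"
proof -
  interpret consistent p r L s by fact
  have h: "h \<in> assigned s" "timing s h = None" "0 < p h" "r h \<le> free s" "h \<notin> set q"
    "h \<notin> interrupted s" "h \<notin> dropped s" "free s + p h \<le> virt s h"
    using queue_sub queue_timing ptime_pos[of h] queue_released[of h] queue_distinct
      interrupted_sub dropped_disjoint virt_covers assms(2) by auto
  show ?thesis
  proof unfold_locales
    fix l assume "l \<in> set (queue (launch p h q s))"
    then show "r l \<le> free (launch p h q s)"
      using queue_released[of l] assms(2) h by (auto simp: launch_def)
  next
    fix l a b assume "timing (launch p h q s) l = Some (a, b)"
    then show "r l \<le> a \<and> a \<le> b \<and> b \<le> a + p l \<and> b \<le> free (launch p h q s) \<and>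
        b \<le> virt (launch p h q s) l"
      using timing_bounds[of l a b] h by (auto simp: launch_def split: if_splits)
  next
    fix l a b assume "timing (launch p h q s) l = Some (a, b)" "l \<notin> interrupted (launch p h q s)"
    then show "b = a + p l"
      using timing_full[of l a b] by (auto simp: launch_def split: if_splits)
  next
    fix k l a b c d
    assume "timing (launch p h q s) k = Some (a, b)" "timing (launch p h q s) l = Some (c, d)" "k \<noteq> l"
    then show "b \<le> c \<or> d \<le> a"
      using timing_disjoint[of k a b l c d] timing_bounds[of k a b] timing_bounds[of l c d]
      by (auto simp: launch_def split: if_splits)
  next
    have "\<forall>l b c. l \<noteq> h \<longrightarrow> timing s l = Some (b, c) \<longrightarrow> c \<le> free s"
      using timing_bounds by blast
    with assms(3) h
    show "\<exists>k a. current (launch p h q s) = Some k \<and>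
        timing (launch p h q s) k = Some (a, free (launch p h q s)) \<and> a \<le> L \<and>
        k \<notin> interrupted (launch p h q s) \<and>
        (\<forall>l b c. l \<noteq> k \<longrightarrow> timing (launch p h q s) l = Some (b, c) \<longrightarrow> c \<le> a)"
      by (auto simp: launch_def)
  qed (use assms(2) h finite_assigned queue_sub queue_distinct queue_sorted ptime_pos
      released virt_ge timing_sub queue_timing interrupted_sub dropped_sub dropped_disjoint
      assigned_cases virt_covers in \<open>auto simp: launch_def\<close>)
qed

lemma consistent_advance:
  assumes "consistent p r L s" "L \<le> t"
  shows "consistent p r t (advance p (\<lambda>x. x < t) s)"
  by (rule advance_invariant[where Q = "consistent p r t"])
    (auto intro: consistent_mono[OF assms] consistent_launch)

text \<open>Draining launches runs after the last arrival, so \<open>L\<close> has to grow along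
  with \<open>free\<close>.\<close>

lemma consistent_drain:
  assumes "consistent p r L s"
  shows "\<exists>L'. consistent p r L' (drain p s)"
proof (rule advance_invariant[where Q = "\<lambda>s. \<exists>L'. consistent p r L' s"])
  fix s h q assume "\<exists>L'. consistent p r L' s" "queue s = h # q"
  then obtain L' where "consistent p r L' s" by blast
  then have "consistent p r (max L' (free s)) s" by (rule consistent_mono) simp
  then have "consistent p r (max L' (free s)) (launch p h q s)"
    using \<open>queue s = h # q\<close> by (rule consistent_launch) simp
  then show "\<exists>L'. consistent p r L' (launch p h q s)" by blast
qed (use assms in blast)

lemma consistent_contend:
  assumes "consistent p r t s" "queue s \<noteq> [] \<Longrightarrow> t \<le> free s"
  shows "consistent p r t (contend m t s)" "t \<le> free (contend m t s)"
proof -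
  interpret consistent p r t s by fact
  show "t \<le> free (contend m t s)" by (auto simp: contend_def Let_def)
  consider "free s \<le> t" | "t < free s" "Suc (hits s) < m" | "t < free s" "\<not> Suc (hits s) < m"
    by linarith
  then show "consistent p r t (contend m t s)"
  proof cases
    case 1
    \<comment> \<open>If jobs are waiting, the premise gives \<open>free s = t\<close>, so raising
      \<open>free\<close> to \<open>t\<close> delays nobody.\<close>
    have cov: "covered p (virt s) t (queue s)"
      using virt_covers assms(2) 1 by (cases "queue s") auto
    have rel: "\<forall>l\<in>set (queue s). r l \<le> t" using queue_released 1 by force
    have tb: "timing s l = Some (a, b) \<Longrightarrow> b \<le> t" for l a b using timing_bounds[of l a b] 1 by simp
    show ?thesis
      by unfold_locales (use 1 cov rel tb finite_assigned queue_sub queue_distinct queue_sorted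
        ptime_pos released virt_ge timing_sub queue_timing interrupted_sub dropped_sub
        dropped_disjoint assigned_cases timing_bounds timing_full timing_disjoint current_sub in
        \<open>auto simp: contend_def\<close>)
  next
    case 2
    have "consistent p r t (s\<lparr>hits := Suc (hits s)\<rparr>)"
      by unfold_locales (use finite_assigned queue_sub queue_distinct queue_sorted queue_released
        ptime_pos released virt_ge timing_sub queue_timing interrupted_sub dropped_sub
        dropped_disjoint assigned_cases timing_bounds timing_full timing_disjoint current_sub
        busy virt_covers in \<open>auto\<close>)
    with 2 show ?thesis by (simp add: contend_def)
  next
    case 3
    obtain k a where k: "current s = Some k" "timing s k = Some (a, free s)" "a \<le> t"
      "k \<notin> interrupted s" "\<And>l b c. l \<noteq> k \<Longrightarrow> timing s l = Some (b, c) \<Longrightarrow> c \<le> a"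
      using busy[OF 3(1)] by blast
    have eq: "contend m t s = s\<lparr>free := t, current := None, hits := 0,
        timing := (timing s)(k \<mapsto> (a, t)), interrupted := insert k (interrupted s)\<rparr>"
      using 3 k by (simp add: contend_def)
    have kb: "r k \<le> a" "free s \<le> a + p k" "free s \<le> virt s k" "k \<in> assigned s"
      using timing_bounds[OF k(2)] timing_sub k(2) by auto
    show ?thesis
      unfolding eq
    \<comment> \<open>The goals are numbered like the assumptions of the locale: 5 is
      \<open>queue_released\<close>, 15 to 17 are the facts on \<open>timing\<close>, 20 is
      \<open>virt_covers\<close>.\<close>
    proof (unfold_locales, goal_cases)
      case (5 l)
      then show ?case using queue_sub released by auto
    next
      case (15 l b c)
      \<comment> \<open>All other runs ended by the start \<open>a \<le> t\<close> of the
        interrupted one, so \<open>t\<close> bounds every end after \<open>free\<close> drops to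
        \<open>t\<close>.\<close>
      then show ?case using timing_bounds[of l b c] k kb 3 by (fastforce split: if_splits)
    next
      case (16 l b c)
      then show ?case using timing_full[of l b c] by (auto split: if_splits)
    next
      case (17 i a' b l c d)
      then show ?case using timing_disjoint[of i a' b l c d] k(2-3) k(5)[of l c d] k(5)[of i a' b]
        by (auto split: if_splits)
    next
      case 20
      show ?case using covered_shift[OF virt_covers, of 0 "virt s" t] 3 by simp
    qed (use k kb 3 finite_assigned queue_sub queue_distinct queue_sorted ptime_pos
      released virt_ge timing_sub queue_timing interrupted_sub dropped_sub dropped_disjoint
      assigned_cases in auto)
  qed
qed

lemma consistent_enqueue:
  assumes "consistent p r t s" "j \<notin> assigned s" "0 < p j" "r j = t" "t \<le> free s"
  shows "consistent p r t (enqueue p j s)"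
proof -
  interpret consistent p r t s by fact
  let ?s = "enqueue p j s"
  have j: "j \<notin> set (queue s)" "timing s j = None" "j \<notin> dropped s"
    using assms(2) queue_sub timing_sub dropped_sub by auto
  have mono: "l \<noteq> j \<Longrightarrow> virt s l \<le> virt ?s l" for l
    using assms(3) by (auto simp: enqueue_def)
  have sum: "0 \<le> (\<Sum>x\<in>{x \<in> set (queue s). p x < p j}. p x)"
    using queue_sub ptime_pos by (intro sum_nonneg) force
  show ?thesis
  proof (unfold_locales, goal_cases)
    case (3)
    show ?case using queue_distinct j by (simp add: distinct_insort)
  next
    case (4)
    show ?case using queue_sorted by (simp add: sorted_insort_key)
  next
    case (8 l)
    show ?case
    proof (cases "l = j")
      case True
      then show ?thesis using sum assms by (simp add: enqueue_def)
    next
      case False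
      with 8 show ?thesis using virt_ge[of l] mono[of l] by simp
    qed
  next
    case (15 l b c)
    with j have "l \<noteq> j" by auto
    with 15 show ?case using timing_bounds[of l b c] mono[of l] by simp
  next
    case 20
    have "(\<Sum>x\<in>{x \<in> set (queue s). p x < p j}. p x) = (\<Sum>x\<leftarrow>filter (\<lambda>x. p x < p j) (queue s). p x)"
      using queue_distinct by (simp add: sum_list_distinct_conv_sum_set)
    then have "covered p (virt ?s) (free s) (insort_key p j (queue s))"
      using mono j assms(3)
      by (intro covered_insort[OF virt_covers queue_sorted]) (auto simp: enqueue_def)
    then show ?case by simp
  qed (use assms j finite_assigned queue_sub queue_released ptime_pos released
      timing_sub queue_timing interrupted_sub dropped_sub dropped_disjoint assigned_cases
      timing_full timing_disjoint current_sub busy in \<open>auto simp: set_insort_key\<close>)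
qed

lemma consistent_shed:
  assumes "consistent p r t s" "queue s \<noteq> []"
  shows "consistent p r t (shed m s)"
proof (cases "ticks s < m")
  case True
  with assms(1) show ?thesis by (simp add: shed_def)
next
  case False
  interpret consistent p r t s by fact
  obtain q x where q: "queue s = q @ [x]" using assms(2) by (metis rev_exhaust)
  have eq: "shed m s = s\<lparr>queue := q, dropped := insert x (dropped s), ticks := 0\<rparr>"
    using False q by (simp add: shed_def)
  show ?thesis
    unfolding eq
    by unfold_locales (use q finite_assigned queue_sub queue_distinct queue_sorted queue_released
      ptime_pos released virt_ge timing_sub queue_timing interrupted_sub dropped_sub
      dropped_disjoint assigned_cases timing_bounds timing_full timing_disjoint current_sub
      busy virt_covers in \<open>auto simp: sorted_append covered_snoc\<close>)
qed

lemma consistent_admit: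
  assumes "consistent p r L s" "L \<le> r j" "j \<notin> assigned s" "0 < p j"
  shows "consistent p r (r j) (admit m p (r j) j s)"
proof -
  let ?s = "advance p (\<lambda>x. x < r j) s"
  note c1 = consistent_advance[OF assms(1,2)]
  have "queue ?s \<noteq> [] \<Longrightarrow> r j \<le> free ?s" using queue_advance[of p "\<lambda>x. x < r j" s] by simp
  note c2 = consistent_contend[OF c1 this]
  have "consistent p r (r j) (enqueue p j (contend m (r j) ?s))"
    by (rule consistent_enqueue[OF c2(1) _ assms(4) _ c2(2)]) (use assms in auto)
  then show ?thesis unfolding admit_def
    by (rule consistent_shed) (metis enqueue_fields(9) insort_not_Nil)
qed

section \<open>Rejection count, padding by dropped jobs, and potential\<close>

definition tally :: "nat \<Rightarrow> mstate \<Rightarrow> bool" where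
  "tally m s \<longleftrightarrow> hits s < m \<and> ticks s < m \<and>
     m * (card (interrupted s) + card (dropped s)) + hits s + ticks s \<le> 2 * card (assigned s)"

text \<open>The gain of dropping: whatever \<open>T\<close>, the waiting jobs that complete after \<open>T\<close> are accompanied by
  at least one dropped job virtually present beyond \<open>T\<close> for every \<open>m - 1\<close> of them, up to a
  rounding error. Dropping the job that would complete last keeps this invariant.\<close>

definition padded :: "nat \<Rightarrow> (job \<Rightarrow> real) \<Rightarrow> mstate \<Rightarrow> bool" where
  "padded m p s \<longleftrightarrow> (\<forall>T. late p (free s) (queue s) T
     \<le> (m - 1) * card {g \<in> dropped s. T < virt s g} + ticks s)"

text \<open>The share of one machine in the total virtual flow time; dropped and interrupted jobs
  are included.\<close>

definition sojourn :: "(job \<Rightarrow> real) \<Rightarrow> mstate \<Rightarrow> real" where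
  "sojourn r s = (\<Sum>l\<in>assigned s. virt s l - r l)"

text \<open>Every job brings a budget of \<open>(m - 1) p\<close>. The at most \<open>m - 1\<close> jobs that arrive during its run
  without interrupting it take from this budget the time they have to wait for the run to end.\<close>

definition pot :: "nat \<Rightarrow> (job \<Rightarrow> real) \<Rightarrow> mstate \<Rightarrow> real" where
  "pot m p s = (real m - 1) * (\<Sum>l\<in>set (queue s). p l) +
     (case current s of None \<Rightarrow> 0 | Some k \<Rightarrow> (real m - 1 - real (hits s)) * p k)"

lemma tally_launch: "tally m s \<Longrightarrow> tally m (launch p h q s)"
  by (auto simp: tally_def launch_def)

lemma tally_advance: "tally m s \<Longrightarrow> tally m (advance p P s)"
  by (rule advance_invariant[where Q = "tally m"]) (auto intro: tally_launch)

text \<open>Each dispatch contributes at most one unit to \<open>hits\<close> and one to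
  \<open>ticks\<close>. An interruption or a drop resets a counter that has collected
  \<open>m\<close> units, which pays for the rejected job.\<close>

lemma tally_admit:
  assumes "consistent p r L s" "L \<le> r j" "j \<notin> assigned s" "0 < p j" "tally m s"
  shows "tally m (admit m p (r j) j s)"
proof -
  define s1 where "s1 = advance p (\<lambda>x. x < r j) s"
  define s2 where "s2 = contend m (r j) s1"
  have c1: "consistent p r (r j) s1" unfolding s1_def by (rule consistent_advance[OF assms(1,2)])
  interpret consistent p r "r j" s1 by (fact c1)
  have fin: "finite (interrupted s1)" "finite (dropped s1)"
    using finite_assigned interrupted_sub timing_sub dropped_sub by (auto intro: finite_subset)
  have t1: "tally m s1" using assms(5) by (simp add: s1_def tally_advance)
  have fld: "assigned s1 = assigned s" by (simp add: s1_def)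
  have "hits s2 < m \<and> m * (card (interrupted s2) + card (dropped s2)) + hits s2 + ticks s2
      \<le> 2 * card (assigned s1) + 1"
  proof (cases "r j < free s1 \<and> \<not> Suc (hits s1) < m")
    case True
    then obtain k where k: "current s1 = Some k" "k \<notin> interrupted s1" using busy by blast
    \<comment> \<open>The bound \<open>hits s1 < m\<close> makes the present hit exactly the
      \<open>m\<close>-th one.\<close>
    have "m = Suc (hits s1)" using True t1 by (auto simp: tally_def)
    then show ?thesis
      using t1 True k fin by (simp add: s2_def contend_def tally_def algebra_simps)
  next
    case False
    then show ?thesis using t1 by (auto simp: s2_def contend_def tally_def)
  qed
  then have main: "hits s2 < m" "m * card (interrupted s2) + m * card (dropped s2) + hits s2 + ticks s2
      \<le> 2 * card (assigned s1) + 1"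
    by (auto simp: algebra_simps)
  have a: "card (insert j (assigned s2)) = Suc (card (assigned s1))"
    using finite_assigned assms(3) fld by (simp add: s2_def)
  have c: "ticks s2 < m" using t1 by (simp add: s2_def tally_def)
  have "card (insert x (dropped s2)) \<le> Suc (card (dropped s2))" for x
    by (rule card_insert_le_m1) auto
  then have d: "m * card (insert x (dropped s2)) \<le> m + m * card (dropped s2)" for x
    using mult_le_mono2[of _ "Suc (card (dropped s2))" m] by simp
  define s3 where "s3 = enqueue p j s2"
  have "tally m (shed m s3)"
  proof (cases "Suc (ticks s2) < m")
    case True
    with main a show ?thesis
      unfolding tally_def by (simp add: shed_def s3_def add_mult_distrib2)
  next
    case False
    with c have "m = Suc (ticks s2)" by simp
    with False main a d[of "last (queue s3)"] show ?thesis
      unfolding tally_def by (simp add: shed_def s3_def add_mult_distrib2)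
  qed
  then show ?thesis
    by (simp add: admit_def s1_def s2_def s3_def)
qed

text \<open>The launched job leaves the count and the others keep their completion times.\<close>

lemma padded_launch: "padded m p s \<Longrightarrow> queue s = h # q \<Longrightarrow> padded m p (launch p h q s)"
proof -
  assume a: "padded m p s" "queue s = h # q"
  have "late p (free s + p h) q T \<le> late p (free s) (queue s) T" for T
    using a(2) by simp
  from le_trans[OF this] a(1) show "padded m p (launch p h q s)"
    unfolding padded_def launch_def by simp
qed

lemma padded_advance: "padded m p s \<Longrightarrow> padded m p (advance p P s)"
  by (rule advance_invariant[where Q = "padded m p"]) (simp_all add: padded_launch)

text \<open>With jobs waiting, \<open>free\<close> can only decrease; with none, the count is
  zero.\<close>

lemma padded_contend:
  assumes "padded m p s" "queue s \<noteq> [] \<Longrightarrow> t \<le> free s"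
  shows "padded m p (contend m t s)"
proof (cases "queue s = []")
  case False
  then have "free (contend m t s) \<le> free s"
    using assms(2) by (auto simp: contend_def Let_def)
  from le_trans[OF late_mono[OF this]] assms(1) show ?thesis
    unfolding padded_def by simp
qed (simp add: padded_def)

text \<open>The insertion adds at most one late job, matched by the increment of
  \<open>ticks\<close>; dropped jobs are outside the queue, so their \<open>virt\<close> stays
  fixed.\<close>

lemma padded_enqueue:
  assumes "consistent p r L s" "j \<notin> assigned s" "padded m p s"
  shows "padded m p (enqueue p j s)"
proof -
  interpret consistent p r L s by fact
  have "{g \<in> dropped s. T < virt (enqueue p j s) g} = {g \<in> dropped s. T < virt s g}" for T
    using dropped_disjoint dropped_sub assms(2) by (auto simp: enqueue_def)
  moreover have "late p (free s) (insort_key p j (queue s)) T \<le> late p (free s) (queue s) T + 1"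
    for T using queue_sorted by (rule late_insort_le)
  moreover have "late p (free s) (queue s) T
      \<le> (m - 1) * card {g \<in> dropped s. T < virt s g} + ticks s" for T
    using assms(3) by (simp add: padded_def)
  ultimately show ?thesis
    unfolding padded_def enqueue_fields by (simp, meson Suc_le_mono le_trans)
qed

text \<open>Let the dropped job \<open>x\<close> be due to end at \<open>?end\<close>. For
  \<open>T < ?end\<close> it leaves the late jobs and joins the padding, so the loss of the
  \<open>m\<close> units of \<open>ticks\<close> is made up by one late job fewer and
  \<open>m - 1\<close> units of padding more. For \<open>T\<close> from \<open>?end\<close> on, no
  remaining job is late.\<close>

lemma padded_shed:
  assumes "consistent p r L s" "queue s \<noteq> []" "padded m p s" "0 < m" "ticks s \<le> m"
  shows "padded m p (shed m s)"
proof (cases "ticks s < m")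
  case True
  with assms(3) show ?thesis by (simp add: shed_def)
next
  case False
  interpret consistent p r L s by fact
  obtain q x where q: "queue s = q @ [x]" using assms(2) by (metis rev_exhaust)
  have eq: "shed m s = s\<lparr>queue := q, dropped := insert x (dropped s), ticks := 0\<rparr>"
    using False q by (simp add: shed_def)
  let ?end = "free s + (\<Sum>x\<leftarrow>q. p x) + p x"
  have x: "x \<notin> dropped s" "?end \<le> virt s x" "finite (dropped s)" "0 < p x"
    using q dropped_disjoint virt_covers dropped_sub finite_assigned finite_subset queue_sub
      ptime_pos by (auto simp: covered_snoc)
  have "late p (free s) q T \<le> (m - 1) * card {g \<in> insert x (dropped s). T < virt s g}" for T
  proof (cases "T < ?end")
    case True
    with x have "{g \<in> insert x (dropped s). T < virt s g} = insert x {g \<in> dropped s. T < virt s g}"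
      by auto
    with x have card: "card {g \<in> insert x (dropped s). T < virt s g}
        = Suc (card {g \<in> dropped s. T < virt s g})"
      by simp
    have "late p (free s) q T + 1 \<le> (m - 1) * card {g \<in> dropped s. T < virt s g} + m"
      using assms(3,5) True q
      by (auto simp: padded_def late_snoc dest!: spec[of _ T])
    with assms(4) show ?thesis unfolding card by (cases m) auto
  next
    case False
    have "late p (free s) q T = 0"
    proof (rule late_eq_0)
      show "\<forall>x\<in>set q. 0 \<le> p x" using q queue_sub ptime_pos by force
    qed (use False x in simp)
    then show ?thesis by simp
  qed
  then show ?thesis unfolding eq padded_def by simp
qed

lemma padded_admit:
  assumes "consistent p r L s" "L \<le> r j" "j \<notin> assigned s" "0 < p j" "padded m p s" "ticks s < m"
  shows "padded m p (admit m p (r j) j s)"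
proof -
  let ?s = "advance p (\<lambda>x. x < r j) s"
  note c1 = consistent_advance[OF assms(1,2)]
  have q: "queue ?s \<noteq> [] \<Longrightarrow> r j \<le> free ?s" using queue_advance[of p "\<lambda>x. x < r j" s] by simp
  note c2 = consistent_contend[OF c1 q]
  note c3 = consistent_enqueue[OF c2(1) _ assms(4) _ c2(2)]
  have "padded m p (contend m (r j) ?s)"
    by (intro padded_contend padded_advance assms q)
  then have "padded m p (enqueue p j (contend m (r j) ?s))"
    by (intro padded_enqueue[OF c2(1)]) (use assms in auto)
  then show ?thesis
    unfolding admit_def
    by (intro padded_shed[OF c3])
      (use assms in \<open>auto simp del: enqueue_fields(9) simp: enqueue_fields(9) insort_not_Nil\<close>)
qed

lemma pot_nonneg:
  assumes "consistent p r L s" "hits s < m"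
  shows "0 \<le> pot m p s"
proof -
  interpret consistent p r L s by fact
  have "0 \<le> (\<Sum>l\<in>set (queue s). p l)"
    using queue_sub ptime_pos by (intro sum_nonneg) force
  moreover have "0 \<le> (real m - 1 - real (hits s)) * p k" if "current s = Some k" for k
    using assms(2) current_sub[OF that] ptime_pos[of k] by simp
  ultimately show ?thesis
    using assms(2) by (auto simp: pot_def split: option.splits)
qed

text \<open>The budget of \<open>h\<close> moves from the queue term to the current term, where
  \<open>hits\<close> starts from 0; the nonnegative rest of the previous budget is given
  up.\<close>

lemma pot_launch:
  assumes "consistent p r L s" "hits s < m" "queue s = h # q"
  shows "pot m p (launch p h q s) \<le> pot m p s"
proof -
  interpret consistent p r L s by fact
  have "0 \<le> (real m - 1 - real (hits s)) * p k" if "current s = Some k" for k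
    using assms(2) current_sub[OF that] ptime_pos[of k] by simp
  moreover have "h \<notin> set q" using queue_distinct assms(3) by simp
  ultimately show ?thesis
    using assms(3) by (auto simp: pot_def launch_def algebra_simps split: option.splits)
qed

lemma pot_advance:
  assumes "consistent p r L s" "L \<le> t" "hits s < m"
  shows "hits (advance p (\<lambda>x. x < t) s) < m" "pot m p (advance p (\<lambda>x. x < t) s) \<le> pot m p s"
proof -
  define Q where "Q s' \<longleftrightarrow> consistent p r t s' \<and> hits s' < m \<and> pot m p s' \<le> pot m p s" for s'
  have "Q (advance p (\<lambda>x. x < t) s)"
  proof (rule advance_invariant)
    show "Q s" using assms by (auto simp: Q_def intro: consistent_mono)
    show "Q (launch p h q s')" if "Q s'" "queue s' = h # q" "free s' < t" for s' h q
      using that consistent_launch[of p r t s' h q] pot_launch[of p r t s' m h q]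
      by (auto simp: Q_def launch_def)
  qed
  then show "hits (advance p (\<lambda>x. x < t) s) < m" "pot m p (advance p (\<lambda>x. x < t) s) \<le> pot m p s"
    by (auto simp: Q_def)
qed

text \<open>The second summand is the wait for the current run. It vanishes on an idle machine and
  after an interruption; otherwise the new hit releases \<open>p k\<close>, which is at least the
  rest of the run.\<close>

lemma pot_contend:
  assumes "consistent p r t s" "hits s < m"
  shows "pot m p (contend m t s) + (free (contend m t s) - t) \<le> pot m p s"
proof -
  interpret consistent p r t s by fact
  show ?thesis
  proof (cases "free s \<le> t")
    case True
    then show ?thesis by (simp add: contend_def pot_def split: option.split)
  next
    case False
    then obtain k a where k: "current s = Some k" "timing s k = Some (a, free s)" "a \<le> t"
      using busy by (meson not_le)
    have "free s \<le> t + p k" using timing_bounds[OF k(2)] k(3) by simp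
    moreover have "0 < p k" using current_sub[OF k(1)] ptime_pos by simp
    moreover have "0 \<le> (real m - 1 - real (hits s)) * p k"
      using assms(2) \<open>0 < p k\<close> by simp
    ultimately show ?thesis
      using False k(1) by (auto simp: contend_def pot_def algebra_simps)
  qed
qed

lemma pot_shed:
  assumes "consistent p r t s" "queue s \<noteq> []" "0 < m"
  shows "pot m p (shed m s) \<le> pot m p s"
proof -
  interpret consistent p r t s by fact
  have "(\<Sum>l\<in>set (queue (shed m s)). p l) \<le> (\<Sum>l\<in>set (queue s). p l)"
  proof (rule sum_mono2)
    show "set (queue (shed m s)) \<subseteq> set (queue s)"
      by (auto simp: shed_def dest: in_set_butlastD)
    show "0 \<le> p b" if "b \<in> set (queue s) - set (queue (shed m s))" for b
      using that queue_sub ptime_pos[of b] by auto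
  qed simp
  with assms(3) show ?thesis
    by (auto simp: pot_def intro!: mult_left_mono split: option.split)
qed

text \<open>A waiting job \<open>l\<close> shorter than \<open>j\<close> delays \<open>j\<close> by
  \<open>p l\<close>; any other one is delayed by \<open>p j\<close>. Either way the increase is the
  minimum.\<close>

lemma sojourn_enqueue:
  assumes "consistent p r t s" "j \<notin> assigned s"
  shows "sojourn r (enqueue p j s) =
    sojourn r s + (free s - r j) + p j + (\<Sum>l\<in>set (queue s). min (p l) (p j))"
proof -
  interpret consistent p r t s by fact
  let ?Q = "set (queue s)"
  have "(\<Sum>l\<in>assigned s. virt (enqueue p j s) l - r l) =
      (\<Sum>l\<in>assigned s. (virt s l - r l) + (if l \<in> ?Q \<and> p j \<le> p l then p j else 0))"
    using assms(2) by (intro sum.cong) (auto simp: enqueue_def)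
  also have "\<dots> = sojourn r s + (\<Sum>l\<in>{l \<in> assigned s. l \<in> ?Q \<and> p j \<le> p l}. p j)"
    using finite_assigned
    by (simp only: sum.distrib sojourn_def sum.inter_filter)
  also have "{l \<in> assigned s. l \<in> ?Q \<and> p j \<le> p l} = {l \<in> ?Q. p j \<le> p l}"
    using queue_sub by auto
  finally have 1: "(\<Sum>l\<in>assigned s. virt (enqueue p j s) l - r l) =
      sojourn r s + (\<Sum>l\<in>{l \<in> ?Q. p j \<le> p l}. p j)" .
  have "(\<Sum>l\<in>?Q. min (p l) (p j)) =
      (\<Sum>l\<in>?Q. (if p l < p j then p l else 0) + (if p j \<le> p l then p j else 0))"
    by (intro sum.cong) auto
  also have "\<dots> = (\<Sum>l\<in>{l \<in> ?Q. p l < p j}. p l) + (\<Sum>l\<in>{l \<in> ?Q. p j \<le> p l}. p j)"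
    by (simp only: sum.distrib sum.inter_filter finite_set)
  finally show ?thesis
    using 1 assms(2) finite_assigned
    by (simp add: sojourn_def) (simp add: enqueue_def)
qed

text \<open>Amortised cost of a dispatch: the wait for the current run is paid by
  \<open>pot_contend\<close>, and \<open>p j\<close> together with the fresh budget
  \<open>(m - 1) * p j\<close> makes the term \<open>m * p j\<close> of \<open>cost\<close>.\<close>

lemma sojourn_admit:
  assumes "consistent p r L s" "L \<le> r j" "j \<notin> assigned s" "0 < p j" "hits s < m"
  shows "sojourn r (admit m p (r j) j s) + pot m p (admit m p (r j) j s)
    \<le> sojourn r s + pot m p s + cost m p (r j) j s"
proof -
  define s1 where "s1 = advance p (\<lambda>x. x < r j) s"
  define s2 where "s2 = contend m (r j) s1"
  define s3 where "s3 = enqueue p j s2"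
  have c1: "consistent p r (r j) s1" unfolding s1_def by (rule consistent_advance[OF assms(1,2)])
  have q: "queue s1 \<noteq> [] \<Longrightarrow> r j \<le> free s1"
    using queue_advance[of p "\<lambda>x. x < r j" s] by (simp add: s1_def)
  note c2 = consistent_contend[OF c1 q, of m, folded s2_def]
  have a: "assigned s2 = assigned s" by (simp add: s1_def s2_def)
  have c3: "consistent p r (r j) s3"
    unfolding s3_def by (rule consistent_enqueue[OF c2(1) _ assms(4) _ c2(2)]) (use assms a in auto)
  have j: "j \<notin> set (queue s2)" using assms(3) a consistent.queue_sub[OF c2(1)] by auto
  have "sojourn r (shed m s3) = sojourn r s3" by (simp add: sojourn_def)
  moreover have "pot m p (shed m s3) \<le> pot m p s3"
    using assms(5) by (intro pot_shed[OF c3]) (auto simp: s3_def insort_not_Nil)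
  moreover have "pot m p s3 = pot m p s2 + (real m - 1) * p j"
    using j by (simp add: pot_def s3_def set_insort_key algebra_simps split: option.split)
  moreover have "pot m p s2 + (free s2 - r j) \<le> pot m p s1"
    unfolding s2_def using pot_advance[OF assms(1,2,5)] by (intro pot_contend[OF c1]) (simp add: s1_def)
  moreover have "pot m p s1 \<le> pot m p s"
    using pot_advance[OF assms(1,2,5)] by (simp add: s1_def)
  moreover have "sojourn r s3 =
      sojourn r s2 + (free s2 - r j) + p j + (\<Sum>l\<in>set (queue s2). min (p l) (p j))"
    unfolding s3_def using sojourn_enqueue[OF c2(1)] assms(3) a by simp
  moreover have "sojourn r s2 = sojourn r s" by (simp add: sojourn_def s1_def s2_def)
  moreover have "cost m p (r j) j s = real m * p j + (\<Sum>l\<in>set (queue s2). min (p l) (p j))"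
    by (simp add: cost_def s1_def s2_def)
  ultimately show ?thesis
    unfolding admit_def s1_def[symmetric] s2_def[symmetric] s3_def[symmetric]
    by (simp add: algebra_simps)
qed

lemma virt_admit_mono:
  assumes "l \<in> assigned s" "j \<notin> assigned s" "0 < p j"
  shows "virt s l \<le> virt (admit m p t j s) l"
  using assms by (auto simp: admit_def enqueue_def)

subsection \<open>Dispatching\<close>

lemma fmeasurable_Ico: "{c..<d :: real} \<in> fmeasurable lborel"
  by (cases "c \<le> d") (auto simp: fmeasurable_def)

text \<open>The run from \<open>a\<close> to \<open>T = a + p j\<close> is hypothetical; later it is
  the run of \<open>j\<close> in an offline schedule. Waiting jobs that end by \<open>T\<close> fit
  into \<open>T - r j\<close>. The \<open>n\<close> late ones cost at most \<open>p j\<close> each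
  and, like the dropped jobs in \<open>B\<close>, are virtually present during the whole
  run.\<close>

lemma cost_le:
  assumes "consistent p r L s" "L \<le> r j" "padded m p s" "ticks s < m" "0 < p j" "r j \<le> a"
  shows "cost m p (r j) j s \<le> (real m + (real m - 1) / real m) * p j + (a + p j - r j) +
    (1 - 1 / real m) *
      (\<Sum>g\<in>assigned s. measure lborel ({a..<a + p j} \<inter> {r g..<virt s g}))"
proof -
  define s1 where "s1 = advance p (\<lambda>x. x < r j) s"
  have c1: "consistent p r (r j) s1" unfolding s1_def by (rule consistent_advance[OF assms(1,2)])
  interpret consistent p r "r j" s1 by (fact c1)
  have fld: "assigned s1 = assigned s" "virt s1 = virt s" "ticks s1 = ticks s"
    by (simp_all add: s1_def)
  define T where "T = a + p j"
  define n where "n = late p (free s1) (queue s1) T"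
  define A where "A = {l \<in> set (queue s1). T < virt s1 l}"
  define B where "B = {g \<in> dropped s1. T < virt s1 g}"
  have "m > 0" using assms(4) by simp
  have pad: "n \<le> (m - 1) * card B + (m - 1)"
  proof -
    have "padded m p s1" using assms(3) by (simp add: s1_def padded_advance)
    then have "n \<le> (m - 1) * card B + ticks s1" by (simp add: n_def B_def padded_def)
    with assms(4) fld show ?thesis by linarith
  qed
  have nA: "n \<le> card A"
    unfolding n_def A_def by (rule covered_late[OF virt_covers queue_distinct])
  have disj: "A \<inter> B = {}" and sub: "A \<union> B \<subseteq> assigned s"
    using dropped_disjoint queue_sub dropped_sub fld by (auto simp: A_def B_def)
  have fin: "finite A" "finite B" using sub finite_assigned fld by (auto intro: finite_subset)
  have pos: "\<forall>x\<in>set (queue s1). 0 \<le> p x" using queue_sub ptime_pos by force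
  have q: "(\<Sum>l\<in>set (queue s1). min (p l) (p j)) \<le> (T - r j) + p j * real n"
  proof (cases "queue s1 = []")
    case True
    then show ?thesis using assms(5,6) by (simp add: T_def)
  next
    case False
    then have "r j \<le> free s1"
      using queue_advance[of p "\<lambda>x. x < r j" s] by (simp add: s1_def)
    moreover have "(\<Sum>l\<in>set (queue s1). min (p l) (p j)) = (\<Sum>l\<leftarrow>queue s1. min (p l) (p j))"
      using queue_distinct by (simp add: sum_list_distinct_conv_sum_set)
    ultimately show ?thesis
      using sum_min_le_late[of "p j" "queue s1" p T "free s1"] pos assms(5,6)
      by (simp add: n_def T_def)
  qed
  have "p j * (card A + card B) = (\<Sum>g\<in>A \<union> B. p j)"
    using fin disj by (simp add: card_Un_disjoint)
  also have "\<dots> \<le> (\<Sum>g\<in>A \<union> B. measure lborel ({a..<a + p j} \<inter> {r g..<virt s g}))"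
  proof (rule sum_mono)
    fix g assume g: "g \<in> A \<union> B"
    then have "r g \<le> a" using sub released[of g] assms(6) fld by force
    moreover have "a + p j \<le> virt s g" using g fld by (auto simp: A_def B_def T_def)
    ultimately have "{a..<a + p j} \<inter> {r g..<virt s g} = {a..<a + p j}" by auto
    then show "p j \<le> measure lborel ({a..<a + p j} \<inter> {r g..<virt s g})"
      using assms(5) by simp
  qed
  also have "\<dots> \<le> (\<Sum>g\<in>assigned s. measure lborel ({a..<a + p j} \<inter> {r g..<virt s g}))"
    using sub finite_assigned fld by (intro sum_mono2) auto
  finally have ov: "p j * (card A + card B) \<le> \<dots>" .
  have "real n \<le> (real m - 1) * real (card B) + (real m - 1)"
  proof -
    have "real n \<le> real ((m - 1) * card B + (m - 1))" using pad by (simp only: of_nat_le_iff)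
    moreover have "real (m - 1) = real m - 1" using \<open>m > 0\<close> by simp
    ultimately show ?thesis by simp
  qed
  \<comment> \<open>Split \<open>m * n\<close> into \<open>(m - 1) * n\<close> and \<open>n\<close>:
    the second part is bounded by the padding, and \<open>n\<close> in the first by
    \<open>card A\<close>. Hence the factor \<open>1 - 1 / m\<close> and the rounding term
    \<open>(m - 1) / m\<close>.\<close>
  then have "real m * real n \<le> (real m - 1) * (real n + real (card B)) + (real m - 1)"
    by (simp add: algebra_simps)
  also have "\<dots> \<le> (real m - 1) * (real (card A) + real (card B)) + (real m - 1)"
    using nA \<open>m > 0\<close> by (intro add_right_mono mult_left_mono) auto
  finally have "real n \<le> ((real m - 1) * (real (card A) + real (card B)) + (real m - 1)) / real m"
    using \<open>m > 0\<close> by (simp add: pos_le_divide_eq mult.commute)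
  also have "\<dots> = (1 - 1 / real m) * (card A + card B) + (real m - 1) / real m"
    using \<open>m > 0\<close> by (simp add: add_divide_distrib diff_divide_distrib left_diff_distrib)
  finally have "real n \<le> (1 - 1 / real m) * (card A + card B) + (real m - 1) / real m" .
  then have "p j * real n \<le> p j * ((1 - 1 / real m) * (card A + card B) + (real m - 1) / real m)"
    using assms(5) by (intro mult_left_mono) auto
  also have "\<dots> = (1 - 1 / real m) * (p j * (card A + card B)) + (real m - 1) / real m * p j"
    by (simp add: algebra_simps)
  also have "\<dots> \<le> (1 - 1 / real m) *
      (\<Sum>g\<in>assigned s. measure lborel ({a..<a + p j} \<inter> {r g..<virt s g})) +
      (real m - 1) / real m * p j"
    using ov \<open>m > 0\<close> by (intro add_right_mono mult_left_mono) auto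
  finally show ?thesis
    using q unfolding cost_def s1_def[symmetric] by (simp add: T_def algebra_simps)
qed

section \<open>The algorithm as a simulation of all machines\<close>

definition target :: "nat \<Rightarrow> sched_instance \<Rightarrow> (machine \<Rightarrow> mstate) \<Rightarrow> job \<Rightarrow> machine" where
  "target m I \<sigma> j = (SOME i. i \<in> machines I \<and> (\<forall>k\<in>machines I.
     cost m (ptime I i) (release I j) j (\<sigma> i) \<le> cost m (ptime I k) (release I j) j (\<sigma> k)))"

definition dispatch ::
  "nat \<Rightarrow> sched_instance \<Rightarrow> job \<Rightarrow> (machine \<Rightarrow> mstate) \<Rightarrow> machine \<Rightarrow> mstate" where
  "dispatch m I j \<sigma> = (let i = target m I \<sigma> j in
     \<sigma>(i := admit m (ptime I i) (release I j) j (\<sigma> i)))"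

definition simulate :: "nat \<Rightarrow> sched_instance \<Rightarrow> job list \<Rightarrow> machine \<Rightarrow> mstate" where
  "simulate m I js = fold (dispatch m I) js (\<lambda>_. idle)"

text \<open>Simultaneous arrivals are ordered by job number, so the order of the known jobs depends
  on their own data only.\<close>

definition arrivals :: "sched_instance \<Rightarrow> job list" where
  "arrivals I = sort_key (release I) (sorted_list_of_set (jobs I))"

definition place :: "sched_instance \<Rightarrow> (machine \<Rightarrow> mstate) \<Rightarrow> job \<Rightarrow> machine" where
  "place I \<sigma> j = (SOME i. i \<in> machines I \<and> j \<in> assigned (\<sigma> i))"

text \<open>It is computed from the whole instance; that actions up to \<open>t\<close> depend only
  on the jobs known at \<open>t\<close> is shown in \<open>online_plan\<close>. Dropped jobs have no
  \<open>timing\<close> and yield \<open>None\<close>.\<close>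

definition plan :: "nat \<Rightarrow> sched_instance \<Rightarrow> schedule" where
  "plan m I j = (if j \<in> jobs I then
     let \<sigma> = simulate m I (arrivals I); i = place I \<sigma> j in
       map_option (\<lambda>(a, b). Run i a b) (timing (drain (ptime I i) (\<sigma> i)) j)
     else None)"

lemma simulate_snoc: "simulate m I (js @ [j]) = dispatch m I j (simulate m I js)"
  by (simp add: simulate_def)

lemma target:
  assumes "finite (machines I)" "machines I \<noteq> {}"
  shows "target m I \<sigma> j \<in> machines I"
    "k \<in> machines I \<Longrightarrow> cost m (ptime I (target m I \<sigma> j)) (release I j) j (\<sigma> (target m I \<sigma> j))
      \<le> cost m (ptime I k) (release I j) j (\<sigma> k)"
proof -
  let ?c = "\<lambda>i. cost m (ptime I i) (release I j) j (\<sigma> i)"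
  have "\<exists>i. i \<in> machines I \<and> (\<forall>k\<in>machines I. ?c i \<le> ?c k)"
    using assms ex_min_if_finite[of "?c ` machines I"]
    by (metis (no_types, lifting) arg_min_if_finite(1,2) linorder_not_le)
  from someI_ex[OF this]
  show "target m I \<sigma> j \<in> machines I"
    "k \<in> machines I \<Longrightarrow> ?c (target m I \<sigma> j) \<le> ?c k"
    by (auto simp: target_def)
qed

lemma arrivals:
  assumes "valid_instance I"
  shows "set (arrivals I) = jobs I" "distinct (arrivals I)" "sorted (map (release I) (arrivals I))"
  using assms by (auto simp: arrivals_def valid_instance_def)

text \<open>Quantifying over \<open>L\<close> lets the next release time be used as \<open>L\<close>
  directly; \<open>L\<ge>0\<close> is what \<open>consistent_idle\<close> requires.\<close>

definition well_run :: "nat \<Rightarrow> sched_instance \<Rightarrow> job list \<Rightarrow> (machine \<Rightarrow> mstate) \<Rightarrow> bool" where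
  "well_run m I js \<sigma> \<longleftrightarrow>
     (\<forall>i\<in>machines I. tally m (\<sigma> i) \<and> padded m (ptime I i) (\<sigma> i) \<and>
       (\<forall>L\<ge>0. (\<forall>j\<in>set js. release I j \<le> L) \<longrightarrow> consistent (ptime I i) (release I) L (\<sigma> i))) \<and>
     (\<Union>i\<in>machines I. assigned (\<sigma> i)) = set js \<and>
     disjoint_family_on (\<lambda>i. assigned (\<sigma> i)) (machines I)"

lemma well_run_simulate:
  assumes "valid_instance I" "0 < m" "set js \<subseteq> jobs I" "distinct js" "sorted (map (release I) js)"
  shows "well_run m I js (simulate m I js)"
  using assms(3-5)
proof (induction js rule: rev_induct)
  case Nil
  show ?case
    using assms(2) consistent_idle
    by (auto simp: well_run_def simulate_def tally_def padded_def idle_def disjoint_family_on_def)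
next
  case (snoc j js)
  define \<sigma> where "\<sigma> = simulate m I js"
  define i where "i = target m I \<sigma> j"
  have wr: "well_run m I js \<sigma>" using snoc by (auto simp: \<sigma>_def sorted_append)
  have j: "j \<in> jobs I" "0 \<le> release I j" "\<And>k. k \<in> machines I \<Longrightarrow> 0 < ptime I k j"
    "\<forall>k\<in>set js. release I k \<le> release I j" "j \<notin> set js"
    using snoc.prems assms(1) by (auto simp: valid_instance_def sorted_append)
  have i: "i \<in> machines I"
    using assms(1) target(1) by (auto simp: i_def valid_instance_def)
  have step: "simulate m I (js @ [j]) = \<sigma>(i := admit m (ptime I i) (release I j) j (\<sigma> i))"
    by (simp add: simulate_snoc dispatch_def \<sigma>_def i_def Let_def)
  have ji: "j \<notin> assigned (\<sigma> k)" if "k \<in> machines I" for k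
    using wr j(5) that by (auto simp: well_run_def)
  have c: "consistent (ptime I i) (release I) (release I j) (\<sigma> i)"
    using wr i j by (auto simp: well_run_def)
  have t: "tally m (\<sigma> i)" "padded m (ptime I i) (\<sigma> i)" using wr i by (auto simp: well_run_def)
  have c': "consistent (ptime I i) (release I) (release I j)
      (admit m (ptime I i) (release I j) j (\<sigma> i))"
    by (rule consistent_admit[OF c]) (use ji i j in auto)
  have t': "tally m (admit m (ptime I i) (release I j) j (\<sigma> i))"
    by (rule tally_admit[OF c]) (use ji i j t in auto)
  have p': "padded m (ptime I i) (admit m (ptime I i) (release I j) j (\<sigma> i))"
    by (rule padded_admit[OF c]) (use ji i j t in \<open>auto simp: tally_def\<close>)
  have "(\<Union>k\<in>machines I. assigned ((\<sigma>(i := admit m (ptime I i) (release I j) j (\<sigma> i))) k))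
      = insert j (\<Union>k\<in>machines I. assigned (\<sigma> k))"
    using i by (auto split: if_splits)
  moreover have "disjoint_family_on
      (\<lambda>k. assigned ((\<sigma>(i := admit m (ptime I i) (release I j) j (\<sigma> i))) k)) (machines I)"
    using wr ji by (auto simp: well_run_def disjoint_family_on_def)
  ultimately show ?case
    unfolding step using wr c' t' p'
    by (auto simp: well_run_def intro: consistent_mono[OF c'])
qed

text \<open>The share of the cost of \<open>j\<close> that is charged to its run in the offline schedule \<open>S\<close>.\<close>

definition dual :: "nat \<Rightarrow> sched_instance \<Rightarrow> schedule \<Rightarrow> (machine \<Rightarrow> mstate) \<Rightarrow> job \<Rightarrow> real" where
  "dual m I S \<sigma> j = (let x = the (S j) in
     (real m + (real m - 1) / real m) * ptime I (mach x) j + (stop x - release I j) +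
     (1 - 1 / real m) * (\<Sum>g\<in>assigned (\<sigma> (mach x)).
        measure lborel ({start x..<stop x} \<inter> {release I g..<virt (\<sigma> (mach x)) g})))"

section \<open>Charging the dispatching costs to an offline schedule\<close>

lemma offline_run:
  assumes "S \<in> offline_schedules I" "j \<in> jobs I"
  shows "\<exists>x. S j = Some x \<and> mach x \<in> machines I \<and> release I j \<le> start x \<and>
    stop x = start x + ptime I (mach x) j"
proof -
  from assms have f: "feasible I S" and "j \<in> completed I S"
    by (auto simp: offline_schedules_def rejected_def)
  then obtain x where "S j = Some x" "stop x = start x + ptime I (mach x) j"
    by (auto simp: completed_def)
  with f assms(2) show ?thesis by (auto simp: feasible_def)
qed

text \<open>Induction over the arrivals: the amortised cost of the new job is at most its
  \<open>dual\<close> in the current state, and \<open>dual\<close> only grows with later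
  dispatches.\<close>

lemma sojourn_simulate:
  assumes "valid_instance I" "0 < m" "S \<in> offline_schedules I"
    "set js \<subseteq> jobs I" "distinct js" "sorted (map (release I) js)"
  shows "(\<Sum>i\<in>machines I. sojourn (release I) (simulate m I js i) + pot m (ptime I i) (simulate m I js i))
    \<le> (\<Sum>j\<in>set js. dual m I S (simulate m I js) j)"
  using assms(4-6)
proof (induction js rule: rev_induct)
  case Nil
  show ?case by (simp add: simulate_def idle_def sojourn_def pot_def)
next
  case (snoc j js)
  define \<sigma> where "\<sigma> = simulate m I js"
  define \<sigma>' where "\<sigma>' = simulate m I (js @ [j])"
  define i where "i = target m I \<sigma> j"
  let ?f = "\<lambda>\<sigma> i. sojourn (release I) (\<sigma> i) + pot m (ptime I i) (\<sigma> i)"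
  have wr: "well_run m I js \<sigma>"
    unfolding \<sigma>_def by (rule well_run_simulate) (use snoc.prems assms in \<open>auto simp: sorted_append\<close>)
  have wr': "well_run m I (js @ [j]) \<sigma>'"
    unfolding \<sigma>'_def by (rule well_run_simulate) (use snoc.prems assms in \<open>auto simp: sorted_append\<close>)
  have IH: "(\<Sum>i\<in>machines I. ?f \<sigma> i) \<le> (\<Sum>j\<in>set js. dual m I S \<sigma> j)"
    using snoc by (auto simp: \<sigma>_def sorted_append)
  have j: "j \<in> jobs I" "0 \<le> release I j" "\<And>k. k \<in> machines I \<Longrightarrow> 0 < ptime I k j"
    "\<forall>k\<in>set js. release I k \<le> release I j" "j \<notin> set js"
    using snoc.prems assms(1) by (auto simp: valid_instance_def sorted_append)
  have finM: "finite (machines I)" "machines I \<noteq> {}"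
    using assms(1) by (auto simp: valid_instance_def)
  have i: "i \<in> machines I" using target(1)[OF finM] by (simp add: i_def)
  have step: "\<sigma>' = \<sigma>(i := admit m (ptime I i) (release I j) j (\<sigma> i))"
    by (simp add: simulate_snoc dispatch_def \<sigma>'_def \<sigma>_def i_def Let_def)
  have ji: "j \<notin> assigned (\<sigma> k)" if "k \<in> machines I" for k
    using wr j(5) that by (auto simp: well_run_def)
  have c: "consistent (ptime I k) (release I) (release I j) (\<sigma> k)" "tally m (\<sigma> k)"
    "padded m (ptime I k) (\<sigma> k)" if "k \<in> machines I" for k
    using wr that j by (auto simp: well_run_def)
  \<comment> \<open>More jobs on a machine and larger \<open>virt\<close> values only enlarge the
    overlaps with a fixed offline run.\<close>
  have dual_mono: "dual m I S \<sigma> l \<le> dual m I S \<sigma>' l" if l: "l \<in> jobs I" for l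
  proof -
    obtain x where x: "S l = Some x" "mach x \<in> machines I" using offline_run[OF assms(3) l] by blast
    let ?k = "mach x"
    let ?o = "\<lambda>\<sigma> g. measure lborel ({start x..<stop x} \<inter> {release I g..<virt (\<sigma> ?k) g})"
    have sub: "assigned (\<sigma> ?k) \<subseteq> assigned (\<sigma>' ?k)" by (auto simp: step)
    have "assigned (\<sigma>' ?k) \<subseteq> set (js @ [j])"
      using wr' x(2) unfolding well_run_def by blast
    then have fin: "finite (assigned (\<sigma>' ?k))" by (rule finite_subset) simp
    have "?o \<sigma> g \<le> ?o \<sigma>' g" if "g \<in> assigned (\<sigma> ?k)" for g
    proof -
      have "virt (\<sigma> ?k) g \<le> virt (\<sigma>' ?k) g"
        using virt_admit_mono[OF that] ji x(2) j(3) by (auto simp: step)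
      then have "{start x..<stop x} \<inter> {release I g..<virt (\<sigma> ?k) g}
          \<subseteq> {start x..<stop x} \<inter> {release I g..<virt (\<sigma>' ?k) g}" by auto
      then show ?thesis
        by (rule measure_mono_fmeasurable) (auto simp: Int_atLeastLessThan intro: fmeasurable_Ico)
    qed
    then have "(\<Sum>g\<in>assigned (\<sigma> ?k). ?o \<sigma> g) \<le> (\<Sum>g\<in>assigned (\<sigma> ?k). ?o \<sigma>' g)"
      by (rule sum_mono)
    also have "\<dots> \<le> (\<Sum>g\<in>assigned (\<sigma>' ?k). ?o \<sigma>' g)"
      using sub fin by (intro sum_mono2) auto
    finally show ?thesis
      using x(1) assms(2) by (auto simp: dual_def Let_def intro!: mult_left_mono)
  qed
  \<comment> \<open>The chosen machine is no more expensive than the machine used by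
    \<open>S\<close>, where \<open>cost_le\<close> applies with \<open>a = start x\<close>.\<close>
  have cost_dual: "cost m (ptime I i) (release I j) j (\<sigma> i) \<le> dual m I S \<sigma> j"
  proof -
    obtain x where x: "S j = Some x" "mach x \<in> machines I" "release I j \<le> start x"
      "stop x = start x + ptime I (mach x) j"
      using offline_run[OF assms(3) j(1)] by blast
    have "cost m (ptime I i) (release I j) j (\<sigma> i)
        \<le> cost m (ptime I (mach x)) (release I j) j (\<sigma> (mach x))"
      unfolding i_def by (rule target(2)[OF finM x(2)])
    also have "\<dots> \<le> dual m I S \<sigma> j"
      using cost_le[OF c(1)[OF x(2)] order_refl c(3)[OF x(2)] _ j(3)[OF x(2)] x(3)] c(2)[OF x(2)] x
      by (simp add: dual_def tally_def)
    finally show ?thesis .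
  qed
  have "(\<Sum>k\<in>machines I. ?f \<sigma>' k) = ?f \<sigma>' i + (\<Sum>k\<in>machines I - {i}. ?f \<sigma>' k)"
    using finM i by (simp add: sum.remove)
  also have "(\<Sum>k\<in>machines I - {i}. ?f \<sigma>' k) = (\<Sum>k\<in>machines I - {i}. ?f \<sigma> k)"
    by (intro sum.cong) (auto simp: step)
  also have "?f \<sigma>' i \<le> ?f \<sigma> i + cost m (ptime I i) (release I j) j (\<sigma> i)"
    using sojourn_admit[OF c(1)[OF i] order_refl ji[OF i] j(3)[OF i]] c(2)[OF i]
    by (simp add: step tally_def)
  also have "?f \<sigma> i + cost m (ptime I i) (release I j) j (\<sigma> i) + (\<Sum>k\<in>machines I - {i}. ?f \<sigma> k)
      = (\<Sum>k\<in>machines I. ?f \<sigma> k) + cost m (ptime I i) (release I j) j (\<sigma> i)"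
    using finM i by (simp add: sum.remove)
  also have "\<dots> \<le> (\<Sum>l\<in>set js. dual m I S \<sigma> l) + dual m I S \<sigma> j"
    using IH cost_dual by simp
  also have "\<dots> = (\<Sum>l\<in>set (js @ [j]). dual m I S \<sigma> l)"
    using j(5) by simp
  also have "\<dots> \<le> (\<Sum>l\<in>set (js @ [j]). dual m I S \<sigma>' l)"
    using dual_mono snoc.prems by (intro sum_mono) auto
  finally show ?case by (simp add: \<sigma>'_def)
qed

text \<open>Used for the offline runs on one machine, which cover no instant of the virtual presence
  of a job twice.\<close>

lemma sum_overlap_le:
  assumes "finite J" "disjoint_family_on A J" "\<And>j. j \<in> J \<Longrightarrow> A j \<in> sets lborel" "c \<le> d"
  shows "(\<Sum>j\<in>J. measure lborel (A j \<inter> {c..<d})) \<le> d - c"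
proof -
  have fm: "A j \<inter> {c..<d} \<in> fmeasurable lborel" if "j \<in> J" for j
    using fmeasurable_Int_fmeasurable[OF fmeasurable_Ico[of c d] assms(3)[OF that]]
    by (simp add: Int_commute)
  have "(\<Sum>j\<in>J. measure lborel (A j \<inter> {c..<d})) = measure lborel (\<Union>j\<in>J. A j \<inter> {c..<d})"
  proof (rule measure_finite_Union[symmetric])
    show "disjoint_family_on (\<lambda>j. A j \<inter> {c..<d}) J"
      using assms(2) by (auto simp: disjoint_family_on_def)
    show "(\<lambda>j. A j \<inter> {c..<d}) ` J \<subseteq> sets lborel" using assms(3) by auto
    show "emeasure lborel (A j \<inter> {c..<d}) \<noteq> \<infinity>" if "j \<in> J" for j
      using fm[OF that] by (auto simp: fmeasurable_def)
  qed fact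
  also have "\<dots> \<le> measure lborel {c..<d}"
    using assms by (intro measure_mono_fmeasurable fmeasurable_Ico) auto
  finally show ?thesis using assms(4) by simp
qed

lemma sojourn_le:
  assumes "valid_instance I" "0 < m" "S \<in> offline_schedules I"
  shows "(\<Sum>i\<in>machines I. sojourn (release I) (simulate m I (arrivals I) i))
    \<le> 2 * (real m)\<^sup>2 * total_flow_time I S"
proof -
  define \<sigma> where "\<sigma> = simulate m I (arrivals I)"
  define \<Phi> where "\<Phi> = (\<Sum>i\<in>machines I. sojourn (release I) (\<sigma> i))"
  define \<mu> where "\<mu> j = mach (the (S j))" for j
  define run where "run j = {start (the (S j))..<stop (the (S j))}" for j
  define ov where "ov j = (\<Sum>g\<in>assigned (\<sigma> (\<mu> j)).
    measure lborel (run j \<inter> {release I g..<virt (\<sigma> (\<mu> j)) g}))" for j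
  let ?c = "real m + (real m - 1) / real m"
  note arr = arrivals[OF assms(1)]
  have wr: "well_run m I (arrivals I) \<sigma>"
    unfolding \<sigma>_def by (rule well_run_simulate) (use assms arr in auto)
  have fin: "finite (machines I)" "finite (jobs I)" using assms(1) by (auto simp: valid_instance_def)
  have run: "\<mu> j \<in> machines I \<and> release I j \<le> start (the (S j)) \<and>
      stop (the (S j)) = start (the (S j)) + ptime I (\<mu> j) j \<and> S j = Some (the (S j))"
    if "j \<in> jobs I" for j
    using offline_run[OF assms(3) that] by (auto simp: \<mu>_def)
  have F: "total_flow_time I S = (\<Sum>j\<in>jobs I. stop (the (S j)) - release I j)"
    using assms(3) unfolding total_flow_time_def
    by (intro sum.cong) (auto simp: offline_schedules_def rejected_def completed_def)
  obtain L where L: "0 \<le> L" "\<forall>j\<in>jobs I. release I j \<le> L"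
  proof
    have "0 \<le> (\<Sum>j\<in>jobs I. release I j)"
      using assms(1) by (intro sum_nonneg) (auto simp: valid_instance_def)
    then show "0 \<le> (\<Sum>j\<in>jobs I. release I j)" .
    show "\<forall>j\<in>jobs I. release I j \<le> (\<Sum>j\<in>jobs I. release I j)"
      using assms(1) by (auto intro!: member_le_sum simp: valid_instance_def)
  qed
  have c: "consistent (ptime I i) (release I) L (\<sigma> i)" "hits (\<sigma> i) < m" if "i \<in> machines I" for i
    using wr that L arr(1) by (auto simp: well_run_def tally_def)
  have overlap: "(\<Sum>j\<in>jobs I. ov j) \<le> \<Phi>"
  proof -
    have "(\<Sum>j\<in>jobs I. ov j) = (\<Sum>i\<in>machines I. \<Sum>j\<in>{j \<in> jobs I. \<mu> j = i}. ov j)"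
      using fin run by (intro sum.group[symmetric]) auto
    \<comment> \<open>Exchanging the sums groups the overlaps by the virtually present job
      \<open>g\<close> rather than by the offline run.\<close>
    also have "\<dots> = (\<Sum>i\<in>machines I. \<Sum>g\<in>assigned (\<sigma> i). \<Sum>j\<in>{j \<in> jobs I. \<mu> j = i}.
        measure lborel (run j \<inter> {release I g..<virt (\<sigma> i) g}))"
      by (intro sum.cong refl trans[OF _ sum.swap]) (auto simp: ov_def)
    also have "\<dots> \<le> \<Phi>"
      unfolding \<Phi>_def sojourn_def
    proof (intro sum_mono)
      fix i g assume i: "i \<in> machines I" and g: "g \<in> assigned (\<sigma> i)"
      show "(\<Sum>j\<in>{j \<in> jobs I. \<mu> j = i}. measure lborel (run j \<inter> {release I g..<virt (\<sigma> i) g}))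
          \<le> virt (\<sigma> i) g - release I g"
      proof (rule sum_overlap_le)
        have fs: "feasible I S" using assms(3) by (simp add: offline_schedules_def)
        have "run j \<inter> run k = {}" if jk: "j \<in> jobs I" "k \<in> jobs I" "j \<noteq> k" "\<mu> j = \<mu> k" for j k
        proof -
          have "S j = Some (the (S j))" "S k = Some (the (S k))" using run jk by auto
          with fs jk show ?thesis unfolding feasible_def run_def \<mu>_def by blast
        qed
        then show "disjoint_family_on run {j \<in> jobs I. \<mu> j = i}"
          by (auto simp: disjoint_family_on_def simp del: Int_iff)
      qed (use fin consistent.virt_ge[OF c(1)[OF i] g] in \<open>auto simp: run_def\<close>)
    qed
    finally show ?thesis .
  qed
  have dual: "dual m I S \<sigma> j \<le> (?c + 1) * (stop (the (S j)) - release I j) + (1 - 1 / real m) * ov j"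
    if "j \<in> jobs I" for j
  proof -
    have "?c * ptime I (\<mu> j) j \<le> ?c * (stop (the (S j)) - release I j)"
      using run[OF that] assms(2) by (intro mult_left_mono) auto
    then show ?thesis
      by (simp add: dual_def Let_def ov_def run_def \<mu>_def algebra_simps)
  qed
  have "\<Phi> \<le> (\<Sum>i\<in>machines I. sojourn (release I) (\<sigma> i) + pot m (ptime I i) (\<sigma> i))"
    unfolding \<Phi>_def by (intro sum_mono) (use pot_nonneg[OF c] in auto)
  also have "\<dots> \<le> (\<Sum>j\<in>jobs I. dual m I S \<sigma> j)"
    using sojourn_simulate[OF assms, of "arrivals I"] arr by (simp add: \<sigma>_def)
  also have "\<dots> \<le> (\<Sum>j\<in>jobs I. (?c + 1) * (stop (the (S j)) - release I j) + (1 - 1 / real m) * ov j)"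
    using dual by (rule sum_mono)
  also have "\<dots> = (?c + 1) * total_flow_time I S + (1 - 1 / real m) * (\<Sum>j\<in>jobs I. ov j)"
    by (simp only: sum.distrib sum_distrib_left F)
  also have "\<dots> \<le> (?c + 1) * total_flow_time I S + (1 - 1 / real m) * \<Phi>"
    using overlap assms(2) by (intro add_left_mono mult_left_mono) auto
  \<comment> \<open>Moving \<open>(1 - 1 / real m) * \<Phi>\<close> to the left leaves the factor
    \<open>1 / real m\<close> there.\<close>
  finally have "\<Phi> / real m \<le> (?c + 1) * total_flow_time I S"
    by (simp add: algebra_simps)
  then have "\<Phi> \<le> real m * ((?c + 1) * total_flow_time I S)"
    using assms(2) by (simp add: pos_divide_le_eq mult.commute)
  also have "\<dots> = ((real m)\<^sup>2 + 2 * real m - 1) * total_flow_time I S"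
    using assms(2) by (simp add: field_simps power2_eq_square)
  also have "\<dots> \<le> 2 * (real m)\<^sup>2 * total_flow_time I S"
  proof (rule mult_right_mono)
    show "(real m)\<^sup>2 + 2 * real m - 1 \<le> 2 * (real m)\<^sup>2"
      \<comment> \<open>The difference of the two sides is the square of
        \<open>real m - 1\<close>.\<close>
      using zero_le_power2[of "real m - 1"] by (simp add: power2_diff)
    show "0 \<le> total_flow_time I S"
      using assms by (intro total_flow_time_nonneg) (auto simp: offline_schedules_def)
  qed
  finally show ?thesis by (simp add: \<Phi>_def \<sigma>_def)
qed

section \<open>Feasibility, rejections and flow time of the resulting schedule\<close>

lemma place:
  assumes "well_run m I js \<sigma>" "j \<in> set js"
  shows "place I \<sigma> j \<in> machines I" "j \<in> assigned (\<sigma> (place I \<sigma> j))"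
proof -
  from assms have "\<exists>i. i \<in> machines I \<and> j \<in> assigned (\<sigma> i)" by (auto simp: well_run_def)
  from someI_ex[OF this] show "place I \<sigma> j \<in> machines I" "j \<in> assigned (\<sigma> (place I \<sigma> j))"
    by (auto simp: place_def)
qed

lemma place_eqI:
  assumes "well_run m I js \<sigma>" "i \<in> machines I" "j \<in> assigned (\<sigma> i)"
  shows "place I \<sigma> j = i"
proof -
  from assms have "j \<in> set js" by (auto simp: well_run_def)
  note place[OF assms(1) this]
  moreover have "disjoint_family_on (\<lambda>i. assigned (\<sigma> i)) (machines I)"
    using assms(1) by (simp add: well_run_def)
  ultimately show ?thesis
    using assms(2,3) unfolding disjoint_family_on_def by blast
qed

lemma well_run_drain:
  assumes "valid_instance I" "well_run m I js \<sigma>" "i \<in> machines I" "set js \<subseteq> jobs I"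
  shows "\<exists>L. consistent (ptime I i) (release I) L (drain (ptime I i) (\<sigma> i))"
proof -
  have fin: "finite (jobs I)" using assms(1) by (auto simp: valid_instance_def)
  let ?L = "\<Sum>j\<in>jobs I. release I j"
  have "0 \<le> ?L" using assms(1) by (intro sum_nonneg) (auto simp: valid_instance_def)
  moreover have "\<forall>j\<in>set js. release I j \<le> ?L"
    using assms(1,4) by (auto intro!: member_le_sum simp: valid_instance_def)
  ultimately have "consistent (ptime I i) (release I) ?L (\<sigma> i)"
    using assms(2,3) by (auto simp: well_run_def)
  then show ?thesis by (rule consistent_drain)
qed

context
  fixes I :: sched_instance and m :: nat and \<sigma> :: "machine \<Rightarrow> mstate"
  assumes valid: "valid_instance I" and m: "0 < m"
  defines "\<sigma> \<equiv> simulate m I (arrivals I)"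
begin

lemma well_run: "well_run m I (arrivals I) \<sigma>"
  unfolding \<sigma>_def by (rule well_run_simulate) (use valid m arrivals[OF valid] in auto)

lemma drained:
  assumes "i \<in> machines I"
  shows "\<exists>L. consistent (ptime I i) (release I) L (drain (ptime I i) (\<sigma> i))"
  using well_run_drain[OF valid well_run assms] arrivals(1)[OF valid] by simp

lemma plan_cases:
  assumes "j \<in> jobs I" "plan m I j = Some x"
  shows "mach x = place I \<sigma> j" "mach x \<in> machines I" "j \<in> assigned (\<sigma> (mach x))"
    "timing (drain (ptime I (mach x)) (\<sigma> (mach x))) j = Some (start x, stop x)"
  using assms place[OF well_run, of j] arrivals(1)[OF valid]
  by (auto simp: plan_def \<sigma>_def Let_def)

lemma feasible_plan: "feasible I (plan m I)"
  unfolding feasible_def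
proof (intro conjI ballI allI impI)
  fix j x assume j: "j \<in> jobs I" "plan m I j = Some x"
  note x = plan_cases[OF j]
  from drained[OF x(2)] obtain L where
    "consistent (ptime I (mach x)) (release I) L (drain (ptime I (mach x)) (\<sigma> (mach x)))" ..
  from consistent.timing_bounds[OF this x(4)] x(2)
  show "mach x \<in> machines I" "release I j \<le> start x" "start x \<le> stop x"
    "stop x \<le> start x + ptime I (mach x) j" by auto
next
  fix j k x y
  assume j: "j \<in> jobs I" and k: "k \<in> jobs I" and "j \<noteq> k"
    and "plan m I j = Some x" "plan m I k = Some y" "mach x = mach y"
  note x = plan_cases[OF j \<open>plan m I j = Some x\<close>] and y = plan_cases[OF k \<open>plan m I k = Some y\<close>]
  from drained[OF x(2)] obtain L where
    "consistent (ptime I (mach x)) (release I) L (drain (ptime I (mach x)) (\<sigma> (mach x)))" ..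
  from consistent.timing_disjoint[OF this x(4) _ \<open>j \<noteq> k\<close>, of "start y" "stop y"] y
  show "{start x..<stop x} \<inter> {start y..<stop y} = {}"
    using \<open>mach x = mach y\<close> by auto
qed

text \<open>After draining the queue is empty, so a job is either dropped or has a run, and a run
  that was not interrupted has full length.\<close>

lemma rejected_plan: "rejected I (plan m I) \<subseteq> (\<Union>i\<in>machines I. interrupted (\<sigma> i) \<union> dropped (\<sigma> i))"
proof
  fix j assume "j \<in> rejected I (plan m I)"
  then have j: "j \<in> jobs I" "j \<notin> completed I (plan m I)" by (auto simp: rejected_def)
  let ?i = "place I \<sigma> j"
  let ?s = "drain (ptime I ?i) (\<sigma> ?i)"
  have i: "?i \<in> machines I" "j \<in> assigned (\<sigma> ?i)"
    using place[OF well_run, of j] j arrivals(1)[OF valid] by auto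
  from drained[OF i(1)] obtain L where "consistent (ptime I ?i) (release I) L ?s" ..
  then interpret consistent "ptime I ?i" "release I" L ?s .
  have "queue ?s = []" using queue_advance[of "ptime I ?i" "\<lambda>_. True"] by blast
  then have cases: "j \<in> dom (timing ?s) \<or> j \<in> dropped (\<sigma> ?i)"
    using assigned_cases i(2) by auto
  have "j \<in> interrupted (\<sigma> ?i)" if t: "timing ?s j = Some (a, b)" for a b
  proof (rule ccontr)
    assume "j \<notin> interrupted (\<sigma> ?i)"
    with timing_full[OF t] have "b = a + ptime I ?i j" by simp
    with t j(1) have "j \<in> completed I (plan m I)"
      by (simp add: completed_def plan_def \<sigma>_def Let_def)
    with j(2) show False by simp
  qed
  with cases i(1) show "j \<in> (\<Union>i\<in>machines I. interrupted (\<sigma> i) \<union> dropped (\<sigma> i))" by auto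
qed

text \<open>The sets \<open>assigned\<close> partition the jobs, and \<open>place\<close> names the
  class of a job.\<close>

lemma sum_assigned:
  "(\<Sum>i\<in>machines I. \<Sum>j\<in>assigned (\<sigma> i). f i j) = (\<Sum>j\<in>jobs I. f (place I \<sigma> j) j)"
proof -
  have fin: "finite (machines I)" "finite (jobs I)" using valid by (auto simp: valid_instance_def)
  have U: "(\<Union>i\<in>machines I. assigned (\<sigma> i)) = jobs I"
    using well_run arrivals(1)[OF valid] by (simp add: well_run_def)
  have "(\<Sum>j\<in>jobs I. f (place I \<sigma> j) j) =
      (\<Sum>i\<in>machines I. \<Sum>j\<in>{j \<in> jobs I. place I \<sigma> j = i}. f (place I \<sigma> j) j)"
    using fin place(1)[OF well_run] arrivals(1)[OF valid] by (intro sum.group[symmetric]) auto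
  also have "\<dots> = (\<Sum>i\<in>machines I. \<Sum>j\<in>assigned (\<sigma> i). f i j)"
  proof (intro sum.cong refl)
    fix i assume "i \<in> machines I"
    then show "{j \<in> jobs I. place I \<sigma> j = i} = assigned (\<sigma> i)"
      using U place[OF well_run] place_eqI[OF well_run] arrivals(1)[OF valid] by fastforce
  qed (simp add: place_eqI[OF well_run])
  finally show ?thesis by simp
qed

lemma card_rejected_plan: "m * card (rejected I (plan m I)) \<le> 2 * card (jobs I)"
proof -
  have fin: "finite (machines I)" "finite (jobs I)" using valid by (auto simp: valid_instance_def)
  let ?R = "\<lambda>i. interrupted (\<sigma> i) \<union> dropped (\<sigma> i)"
  have finR: "finite (?R i)" if "i \<in> machines I" for i
  proof -
    from drained[OF that] obtain L where
      "consistent (ptime I i) (release I) L (drain (ptime I i) (\<sigma> i))" ..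
    then interpret consistent "ptime I i" "release I" L "drain (ptime I i) (\<sigma> i)" .
    show ?thesis
      using finite_assigned interrupted_sub timing_sub dropped_sub
      by (auto intro: finite_subset[of _ "assigned (\<sigma> i)"])
  qed
  have "m * card (rejected I (plan m I)) \<le> m * (\<Sum>i\<in>machines I. card (?R i))"
  proof (rule mult_le_mono2)
    have "card (rejected I (plan m I)) \<le> card (\<Union>i\<in>machines I. ?R i)"
      using fin finR by (intro card_mono rejected_plan finite_UN_I) auto
    also have "\<dots> \<le> (\<Sum>i\<in>machines I. card (?R i))" using fin(1) by (rule card_UN_le)
    finally show "card (rejected I (plan m I)) \<le> \<dots>" .
  qed
  also have "\<dots> = (\<Sum>i\<in>machines I. m * card (?R i))" by (simp add: sum_distrib_left)
  also have "\<dots> \<le> (\<Sum>i\<in>machines I. 2 * card (assigned (\<sigma> i)))"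
  proof (rule sum_mono)
    fix i assume "i \<in> machines I"
    then have t: "tally m (\<sigma> i)" using well_run by (simp add: well_run_def)
    have "m * card (?R i) \<le> m * (card (interrupted (\<sigma> i)) + card (dropped (\<sigma> i)))"
      by (intro mult_le_mono2 card_Un_le)
    with t show "m * card (?R i) \<le> 2 * card (assigned (\<sigma> i))" unfolding tally_def by linarith
  qed
  also have "\<dots> = 2 * card (jobs I)"
    using sum_assigned[of "\<lambda>_ _. 1 :: nat"] by (simp flip: sum_distrib_left)
  finally show ?thesis .
qed

text \<open>A completed job stops by its virtual completion time; including the rejected jobs only
  adds nonnegative terms.\<close>

lemma total_flow_time_plan:
  "total_flow_time I (plan m I) \<le> (\<Sum>i\<in>machines I. sojourn (release I) (\<sigma> i))"
proof -
  have fin: "finite (jobs I)" using valid by (auto simp: valid_instance_def)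
  let ?v = "\<lambda>j. virt (\<sigma> (place I \<sigma> j)) j"
  have "total_flow_time I (plan m I) \<le> (\<Sum>j\<in>completed I (plan m I). ?v j - release I j)"
    unfolding total_flow_time_def
  proof (rule sum_mono)
    fix j assume "j \<in> completed I (plan m I)"
    then obtain x where j: "j \<in> jobs I" "plan m I j = Some x" by (auto simp: completed_def)
    note x = plan_cases[OF j]
    from drained[OF x(2)] obtain L where
      "consistent (ptime I (mach x)) (release I) L (drain (ptime I (mach x)) (\<sigma> (mach x)))" ..
    from consistent.timing_bounds[OF this x(4)] x(1) j(2)
    show "stop (the (plan m I j)) - release I j \<le> ?v j - release I j" by simp
  qed
  also have "\<dots> \<le> (\<Sum>j\<in>jobs I. ?v j - release I j)"
  proof (rule sum_mono2[OF fin])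
    fix j assume "j \<in> jobs I - completed I (plan m I)"
    then have p: "place I \<sigma> j \<in> machines I" "j \<in> assigned (\<sigma> (place I \<sigma> j))"
      using place[OF well_run, of j] arrivals(1)[OF valid] by auto
    from drained[OF p(1)] obtain L where
      "consistent (ptime I (place I \<sigma> j)) (release I) L
        (drain (ptime I (place I \<sigma> j)) (\<sigma> (place I \<sigma> j)))" ..
    from consistent.virt_ge[OF this] p(2) show "0 \<le> ?v j - release I j" by simp
  qed (auto simp: completed_def)
  also have "\<dots> = (\<Sum>i\<in>machines I. sojourn (release I) (\<sigma> i))"
    unfolding sojourn_def by (rule sum_assigned[symmetric])
  finally show ?thesis .
qed

lemma plan_competitive: "total_flow_time I (plan m I) \<le> 2 * (real m)\<^sup>2 * opt_flow_time I"
proof -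
  \<comment> \<open>Dividing by the factor isolates the infimum, and \<open>sojourn_le\<close>
    bounds every member of its set.\<close>
  have "total_flow_time I (plan m I) / (2 * (real m)\<^sup>2) \<le> opt_flow_time I"
    unfolding opt_flow_time_def
  proof (rule cInf_greatest)
    show "total_flow_time I ` offline_schedules I \<noteq> {}"
      using offline_schedules_nonempty[OF valid] by simp
    fix y assume "y \<in> total_flow_time I ` offline_schedules I"
    then obtain S where "S \<in> offline_schedules I" "y = total_flow_time I S" by auto
    with sojourn_le[OF valid m] total_flow_time_plan
    show "total_flow_time I (plan m I) / (2 * (real m)\<^sup>2) \<le> y"
      using m by (fastforce simp: \<sigma>_def pos_divide_le_eq mult.commute intro: order_trans)
  qed
  then show ?thesis using m by (simp add: pos_divide_le_eq mult.commute)
qed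

end

subsection \<open>Non-anticipation\<close>

definition snap :: "real \<Rightarrow> (real \<times> real) option \<Rightarrow> (real \<times> real option) option" where
  "snap t e = (case e of None \<Rightarrow> None | Some (a, b) \<Rightarrow>
     if a \<le> t then Some (a, if b \<le> t then Some b else None) else None)"

text \<open>All further launches start at \<open>free s\<close> or later, hence after
  \<open>t\<close>.\<close>

lemma snap_advance:
  assumes "consistent p r L s" "t < free s"
  shows "snap t (timing (advance p P s) l) = snap t (timing s l)"
proof -
  interpret consistent p r L s by fact
  define Q where "Q s' \<longleftrightarrow> t < free s' \<and> distinct (queue s') \<and>
    (\<forall>x\<in>set (queue s'). timing s' x = None \<and> 0 < p x) \<and>
    (\<forall>l. snap t (timing s' l) = snap t (timing s l))" for s' :: mstate
  have "Q (advance p P s)"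
  proof (rule advance_invariant)
    show "Q s" using assms(2) queue_distinct queue_timing queue_sub ptime_pos
      by (auto simp: Q_def)
    show "Q (launch p h q s')" if "Q s'" "queue s' = h # q" for s' h q
    proof -
      have "timing s' h = None" using that by (simp add: Q_def)
      moreover have "snap t (timing s' h) = snap t (timing s h)"
        using that(1) unfolding Q_def by blast
      ultimately have "snap t (timing s h) = None" by (simp add: snap_def)
      with that show ?thesis by (auto simp: Q_def launch_def snap_def)
    qed
  qed
  then show ?thesis by (simp add: Q_def)
qed

text \<open>An interruption at \<open>u\<close> moves the end of a run from a time after
  \<open>u\<close> to \<open>u\<close> itself; at \<open>t < u\<close> neither end is
  visible.\<close>

lemma snap_contend:
  assumes "consistent p r u s" "t < u"
  shows "snap t (timing (contend m u s) l) = snap t (timing s l)"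
proof (cases "free s \<le> u \<or> Suc (hits s) < m")
  case True
  then show ?thesis by (auto simp: contend_def)
next
  case False
  then obtain k a where "current s = Some k" "timing s k = Some (a, free s)"
    using consistent.busy[OF assms(1)] by fastforce
  with False assms(2) show ?thesis by (auto simp: contend_def snap_def)
qed

text \<open>Both drains are compared with the state \<open>s1\<close> just before the arrival is
  handled. With jobs waiting, its \<open>free\<close> is past \<open>t\<close>, so further launches
  are invisible; with an empty queue there is nothing to launch.\<close>

lemma snap_admit:
  assumes "consistent p r L s" "L \<le> r j" "j \<notin> assigned s" "0 < p j" "t < r j"
  shows "snap t (timing (drain p (admit m p (r j) j s)) l) = snap t (timing (drain p s) l)"
proof -
  define s1 where "s1 = advance p (\<lambda>x. x < r j) s"
  have c1: "consistent p r (r j) s1" unfolding s1_def by (rule consistent_advance[OF assms(1,2)])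
  have q: "queue s1 \<noteq> [] \<Longrightarrow> r j \<le> free s1"
    using queue_advance[of p "\<lambda>x. x < r j" s] by (simp add: s1_def)
  note c2 = consistent_contend[OF c1 q]
  have "snap t (timing (drain p (admit m p (r j) j s)) l) = snap t (timing (admit m p (r j) j s) l)"
    using c2(2)[of m] assms(5)
    by (intro snap_advance[OF consistent_admit[OF assms(1-4)]]) (simp add: admit_def s1_def)
  also have "\<dots> = snap t (timing s1 l)"
    using snap_contend[OF c1 assms(5)] by (simp add: admit_def s1_def)
  also have "\<dots> = snap t (timing (drain p s1) l)"
  proof (cases "queue s1 = []")
    case True
    then show ?thesis by (simp add: advance_def)
  next
    case False
    with q assms(5) have "t < free s1" by simp
    from snap_advance[OF c1 this] show ?thesis by simp
  qed
  also have "drain p s1 = drain p s" by (simp add: s1_def drain_advance)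
  finally show ?thesis .
qed

text \<open>The inclusion of the assigned sets ensures that \<open>place\<close> gives the same
  machine in both simulations.\<close>

lemma snap_simulate:
  assumes "valid_instance I" "0 < m" "i \<in> machines I" "set (ks @ ls) \<subseteq> jobs I" "distinct (ks @ ls)"
    "sorted (map (release I) (ks @ ls))" "\<forall>l\<in>set ls. t < release I l"
  shows "assigned (simulate m I ks i) \<subseteq> assigned (simulate m I (ks @ ls) i) \<and>
    snap t (timing (drain (ptime I i) (simulate m I (ks @ ls) i)) k) =
    snap t (timing (drain (ptime I i) (simulate m I ks i)) k)"
  using assms(4-7)
proof (induction ls rule: rev_induct)
  case (snoc j ls)
  define \<sigma> where "\<sigma> = simulate m I (ks @ ls)"
  have pre: "set (ks @ ls) \<subseteq> jobs I" "distinct (ks @ ls)" "sorted (map (release I) (ks @ ls))"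
    "\<forall>l\<in>set ls. t < release I l"
    using snoc.prems by (auto simp: sorted_append)
  have wr: "well_run m I (ks @ ls) \<sigma>"
    unfolding \<sigma>_def by (rule well_run_simulate[OF assms(1,2) pre(1-3)])
  have IH: "assigned (simulate m I ks i) \<subseteq> assigned (\<sigma> i)"
    "snap t (timing (drain (ptime I i) (\<sigma> i)) k) =
      snap t (timing (drain (ptime I i) (simulate m I ks i)) k)"
    using snoc.IH[OF pre] by (simp_all add: \<sigma>_def)
  have j: "0 \<le> release I j" "0 < ptime I i j" "j \<notin> set (ks @ ls)" "t < release I j"
    "\<forall>k\<in>set (ks @ ls). release I k \<le> release I j"
    using snoc.prems assms(1,3) by (auto simp: valid_instance_def sorted_append)
  have ji: "j \<notin> assigned (\<sigma> i)"
    using wr assms(3) j(3) unfolding well_run_def by blast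
  have c: "consistent (ptime I i) (release I) (release I j) (\<sigma> i)"
    using wr assms(3) j(1,5) unfolding well_run_def by blast
  have eq: "simulate m I (ks @ ls @ [j]) = dispatch m I j \<sigma>"
    using simulate_snoc[of m I "ks @ ls" j] by (simp add: \<sigma>_def)
  show ?case
    using IH snap_admit[where r = "release I", OF c order_refl ji j(2,4)]
    unfolding eq by (auto simp: dispatch_def Let_def)
qed simp

section \<open>Dependence of the simulation on the known data only\<close>

lemma launches_cong:
  "\<forall>x\<in>set q. p x = p' x \<Longrightarrow> launches p P q s = launches p' P q s"
  by (induction q arbitrary: s) (auto simp: launch_def)

lemma advance_cong:
  "\<forall>x\<in>set (queue s). p x = p' x \<Longrightarrow> advance p P s = advance p' P s"
  by (simp add: advance_def launches_cong)

lemma queue_advance_subset: "set (queue (advance p P s)) \<subseteq> set (queue s)"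
  by (rule advance_invariant[where Q = "\<lambda>s'. set (queue s') \<subseteq> set (queue s)"])
    (auto simp: launch_def)

lemma insort_key_cong:
  "\<forall>x\<in>insert j (set q). p x = p' x \<Longrightarrow> insort_key p j q = insort_key p' j q"
  by (induction q) auto

lemma sort_key_cong:
  "\<forall>x\<in>set xs. f x = g x \<Longrightarrow> sort_key f xs = sort_key g xs"
  by (induction xs) (auto intro!: insort_key_cong)

lemma enqueue_cong:
  assumes "\<forall>x\<in>insert j (set (queue s)). p x = p' x"
  shows "enqueue p j s = enqueue p' j s"
proof -
  have sum: "(\<Sum>x\<in>{x \<in> set (queue s). p x < p j}. p x) =
      (\<Sum>x\<in>{x \<in> set (queue s). p' x < p' j}. p' x)"
    using assms by (intro sum.cong) auto
  have pj: "p j = p' j" using assms by simp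
  have "virt (enqueue p j s) l = virt (enqueue p' j s) l" for l
  proof (cases "l = j")
    case True
    then show ?thesis using sum pj by (simp add: enqueue_def)
  next
    case False
    then show ?thesis using assms by (auto simp: enqueue_def)
  qed
  then show ?thesis
    using insort_key_cong[OF assms]
    by (intro mstate.equality ext) simp_all
qed

text \<open>A machine looks up processing times only for its queue and for the arriving job.\<close>

lemma admit_cong:
  assumes "\<forall>x\<in>insert j (set (queue s)). p x = p' x"
  shows "admit m p t j s = admit m p' t j s"
proof -
  have "advance p (\<lambda>x. x < t) s = advance p' (\<lambda>x. x < t) s"
    using assms by (intro advance_cong) auto
  then show ?thesis
    using queue_advance_subset[of p' "\<lambda>x. x < t" s] assms
    unfolding admit_def by (subst enqueue_cong[of _ _ p p']) auto
qed

lemma cost_cong: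
  assumes "\<forall>x\<in>insert j (set (queue s)). p x = p' x"
  shows "cost m p t j s = cost m p' t j s"
proof -
  have "advance p (\<lambda>x. x < t) s = advance p' (\<lambda>x. x < t) s"
    using assms by (intro advance_cong) auto
  then show ?thesis
    using queue_advance_subset[of p' "\<lambda>x. x < t" s] assms
    unfolding cost_def by (auto intro!: sum.cong)
qed

lemma simulate_cong:
  assumes "valid_instance I" "0 < m" "machines I = machines I'"
    "set js \<subseteq> jobs I" "distinct js" "sorted (map (release I) js)"
    "\<forall>j\<in>set js. release I j = release I' j \<and> (\<forall>i\<in>machines I. ptime I i j = ptime I' i j)"
  shows "simulate m I js = simulate m I' js"
  using assms(4-7)
proof (induction js rule: rev_induct)
  case Nil
  then show ?case by (simp add: simulate_def)
next
  case (snoc j js)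
  define \<sigma> where "\<sigma> = simulate m I js"
  have \<sigma>': "simulate m I' js = \<sigma>" using snoc by (auto simp: \<sigma>_def sorted_append)
  have wr: "well_run m I js \<sigma>"
    unfolding \<sigma>_def by (rule well_run_simulate) (use snoc.prems assms in \<open>auto simp: sorted_append\<close>)
  have j: "0 \<le> release I j" "\<forall>k\<in>set js. release I k \<le> release I j" "release I' j = release I j"
    using snoc.prems assms(1) by (auto simp: valid_instance_def sorted_append)
  have p: "\<forall>x\<in>insert j (set (queue (\<sigma> i))). ptime I i x = ptime I' i x" if "i \<in> machines I" for i
  proof -
    have "consistent (ptime I i) (release I) (release I j) (\<sigma> i)"
      using wr that j unfolding well_run_def by blast
    then have "set (queue (\<sigma> i)) \<subseteq> assigned (\<sigma> i)" by (rule consistent.queue_sub)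
    also have "\<dots> \<subseteq> set js" using wr that unfolding well_run_def by blast
    finally show ?thesis using snoc.prems(4) that by auto
  qed
  \<comment> \<open>The costs agree on every machine, so the choice operator is applied to equal
    predicates and ties are resolved alike.\<close>
  have tgt: "target m I \<sigma> j = target m I' \<sigma> j"
    unfolding target_def assms(3)[symmetric] j(3)
    using cost_cong[OF p] by (metis (no_types, lifting))
  have "target m I \<sigma> j \<in> machines I"
    using assms(1) by (intro target(1)) (auto simp: valid_instance_def)
  from admit_cong[OF p[OF this]] show ?case
    by (simp add: simulate_snoc \<sigma>' dispatch_def j(3) flip: tgt \<sigma>_def)
qed

lemma sorted_split:
  "sorted (map f xs) \<Longrightarrow> xs = filter (\<lambda>x. f x \<le> t) xs @ filter (\<lambda>x. t < f x) xs"
proof (induction xs)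
  case (Cons x xs)
  show ?case
  proof (cases "f x \<le> t")
    case False
    with Cons.prems have "\<forall>y\<in>set xs. t < f y" by force
    then have "filter (\<lambda>y. f y \<le> t) xs = []" "filter (\<lambda>y. t < f y) xs = xs"
      by (auto simp: filter_empty_conv)
    with False show ?thesis by simp
  qed (use Cons in simp)
qed simp

text \<open>Filtering commutes with the stable sort, so the arrivals up to \<open>t\<close> are
  determined by the known jobs and their release times.\<close>

lemma filter_arrivals:
  assumes "finite (jobs I)"
  shows "filter (\<lambda>j. release I j \<le> t) (arrivals I) =
    sort_key (release I) (sorted_list_of_set (known_jobs I t))"
proof -
  have "filter (\<lambda>j. release I j \<le> t) (sorted_list_of_set (jobs I)) =
      sorted_list_of_set (known_jobs I t)"
    using assms by (intro sorted_distinct_set_unique) (auto simp: known_jobs_def sorted_wrt_filter)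
  then show ?thesis by (simp add: arrivals_def filter_sort)
qed

text \<open>Up to \<open>t\<close> the plan looks as if the jobs released by \<open>t\<close> were
  all the jobs: \<open>snap_simulate\<close> removes the later arrivals.\<close>

lemma history_plan:
  assumes "valid_instance I" "0 < m" "j \<in> known_jobs I t"
  defines "\<sigma> \<equiv> simulate m I (filter (\<lambda>j. release I j \<le> t) (arrivals I))"
  shows "history t (plan m I) j = map_option (\<lambda>(a, c). (place I \<sigma> j, a, c))
    (snap t (timing (drain (ptime I (place I \<sigma> j)) (\<sigma> (place I \<sigma> j))) j))"
proof -
  define ks where "ks = filter (\<lambda>j. release I j \<le> t) (arrivals I)"
  define ls where "ls = filter (\<lambda>j. t < release I j) (arrivals I)"
  define \<tau> where "\<tau> = simulate m I (arrivals I)"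
  note arr = arrivals[OF assms(1)]
  have split: "arrivals I = ks @ ls"
    unfolding ks_def ls_def by (rule sorted_split[OF arr(3)])
  have \<sigma>: "simulate m I ks = \<sigma>" and \<tau>: "simulate m I (ks @ ls) = \<tau>"
    unfolding \<sigma>_def \<tau>_def ks_def[symmetric] by (simp_all only: split[symmetric])
  have late: "\<forall>l\<in>set ls. t < release I l" by (simp add: ls_def)
  have js: "set ks \<subseteq> jobs I" "distinct ks" "sorted (map (release I) ks)"
    using arr split by (auto simp: sorted_append)
  have wr: "well_run m I ks \<sigma>" "well_run m I (arrivals I) \<tau>"
    unfolding \<sigma>_def \<tau>_def ks_def[symmetric]
    by (rule well_run_simulate[OF assms(1,2)], use js arr in auto)+
  let ?i = "place I \<sigma> j"
  have "j \<in> set ks" "j \<in> jobs I" using assms(3) arr by (auto simp: ks_def known_jobs_def)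
  then have i: "?i \<in> machines I" "j \<in> assigned (\<sigma> ?i)" using place[OF wr(1)] by auto
  have "assigned (\<sigma> ?i) \<subseteq> assigned (\<tau> ?i) \<and>
    snap t (timing (drain (ptime I ?i) (\<tau> ?i)) j) = snap t (timing (drain (ptime I ?i) (\<sigma> ?i)) j)"
    by (rule snap_simulate[OF assms(1,2) i(1), of ks ls, unfolded \<sigma> \<tau>])
      (use arr[unfolded split] late in simp_all)
  moreover from this have "place I \<tau> j = ?i" using i by (intro place_eqI[OF wr(2)]) auto
  moreover have "history t (plan m I) j = map_option (\<lambda>(a, c). (place I \<tau> j, a, c))
    (snap t (timing (drain (ptime I (place I \<tau> j)) (\<tau> (place I \<tau> j))) j))"
    using \<open>j \<in> jobs I\<close>
    by (auto simp: history_def plan_def Let_def snap_def \<tau>_def split: option.split)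
  ultimately show ?thesis by simp
qed

lemma online_plan:
  assumes "0 < m"
  shows "online_algorithm (plan m)"
  unfolding online_algorithm_def
proof (intro conjI allI impI ballI)
  fix I assume "valid_instance I"
  then show "feasible I (plan m I)" using assms by (rule feasible_plan)
next
  fix I I' :: sched_instance and t j
  assume v: "valid_instance I" "valid_instance I'" and agree: "agree_until t I I'"
    and j: "j \<in> known_jobs I t"
  define ks where "ks = filter (\<lambda>j. release I j \<le> t) (arrivals I)"
  define \<sigma> where "\<sigma> = simulate m I ks"
  have M: "machines I = machines I'" and K: "known_jobs I t = known_jobs I' t"
    and data: "\<forall>j\<in>known_jobs I t. release I j = release I' j \<and>
      (\<forall>i\<in>machines I. ptime I i j = ptime I' i j)"
    using agree by (auto simp: agree_until_def)
  have fin: "finite (jobs I)" "finite (jobs I')" using v by (auto simp: valid_instance_def)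
  have finK: "finite (known_jobs I t)" using fin by (simp add: known_jobs_def)
  have ks': "filter (\<lambda>j. release I' j \<le> t) (arrivals I') = ks"
    unfolding ks_def filter_arrivals[OF fin(1)] filter_arrivals[OF fin(2)] K[symmetric]
    using data finK by (intro sort_key_cong) auto
  have setks: "set ks = known_jobs I t"
    using arrivals(1)[OF v(1)] by (auto simp: ks_def known_jobs_def)
  have js: "set ks \<subseteq> jobs I" "distinct ks" "sorted (map (release I) ks)"
    using arrivals[OF v(1)] by (auto simp: ks_def sorted_filter)
  have \<sigma>': "simulate m I' ks = \<sigma>"
    unfolding \<sigma>_def using simulate_cong[OF v(1) assms M js] data setks by simp
  have wr: "well_run m I ks \<sigma>" unfolding \<sigma>_def by (rule well_run_simulate[OF v(1) assms js])
  let ?i = "place I \<sigma> j"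
  \<comment> \<open>For a fixed state, \<open>place\<close> depends on the instance through its
    machines only.\<close>
  have pl: "place I' \<sigma> j = ?i" by (simp add: place_def M)
  have i: "?i \<in> machines I" using place(1)[OF wr] j setks by simp
  have "drain (ptime I ?i) (\<sigma> ?i) = drain (ptime I' ?i) (\<sigma> ?i)"
  proof (rule advance_cong)
    have "set (queue (\<sigma> ?i)) \<subseteq> assigned (\<sigma> ?i)"
    proof -
      have "0 \<le> max 0 t" "\<forall>l\<in>set ks. release I l \<le> max 0 t"
        using setks by (auto simp: known_jobs_def)
      then have "consistent (ptime I ?i) (release I) (max 0 t) (\<sigma> ?i)"
        using wr i unfolding well_run_def by blast
      then show ?thesis by (rule consistent.queue_sub)
    qed
    also have "\<dots> \<subseteq> set ks" using wr i unfolding well_run_def by blast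
    finally show "\<forall>x\<in>set (queue (\<sigma> ?i)). ptime I ?i x = ptime I' ?i x"
      using data setks i by auto
  qed
  with history_plan[OF v(1) assms j] history_plan[OF v(2) assms, of j t] j K
  show "history t (plan m I) j = history t (plan m I') j"
    by (simp add: ks' \<sigma>' pl flip: ks_def \<sigma>_def)
qed

theorem theorem1:
  fixes \<epsilon> :: real
  assumes "0 < \<epsilon>"
  shows "\<exists>A. online_algorithm A \<and>
    (\<forall>I. valid_instance I \<longrightarrow>
       real (card (rejected I (A I))) \<le> 2 * \<epsilon> * real (card (jobs I)) \<and>
       total_flow_time I (A I) \<le> 2 * ((1 + \<epsilon>) / \<epsilon>)\<^sup>2 * opt_flow_time I)"
proof -
  \<comment> \<open>As \<open>m\<close> is at least \<open>1 / \<epsilon>\<close>, the rejected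
    fraction \<open>2 / m\<close> is at most \<open>2 * \<epsilon>\<close>; as rounding up adds at
    most 1, \<open>m\<close> is at most \<open>(1 + \<epsilon>) / \<epsilon>\<close>.\<close>
  define m where "m = nat \<lceil>1 / \<epsilon>\<rceil>"
  have m: "0 < m" "1 / \<epsilon> \<le> real m" "real m \<le> (1 + \<epsilon>) / \<epsilon>"
  proof -
    have "0 < 1 / \<epsilon>" using assms by simp
    then show "0 < m" "1 / \<epsilon> \<le> real m" unfolding m_def by linarith+
    have "real m \<le> 1 / \<epsilon> + 1" using \<open>0 < 1 / \<epsilon>\<close> unfolding m_def by linarith
    with assms show "real m \<le> (1 + \<epsilon>) / \<epsilon>" by (simp add: add_divide_distrib)
  qed
  show ?thesis
  proof (intro exI conjI allI impI)
    show "online_algorithm (plan m)" using m(1) by (rule online_plan)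
    fix I assume I: "valid_instance I"
    let ?R = "real (card (rejected I (plan m I)))"
    have "?R = \<epsilon> * (1 / \<epsilon> * ?R)" using assms by simp
    also have "\<dots> \<le> \<epsilon> * (real m * ?R)"
      using assms m(2) by (intro mult_left_mono mult_right_mono) auto
    also have "\<dots> \<le> \<epsilon> * (2 * real (card (jobs I)))"
    proof (rule mult_left_mono)
      have "real (m * card (rejected I (plan m I))) \<le> real (2 * card (jobs I))"
        using card_rejected_plan[OF I m(1)] by (rule of_nat_mono)
      then show "real m * ?R \<le> 2 * real (card (jobs I))" by simp
    qed (use assms in simp)
    finally show "?R \<le> 2 * \<epsilon> * real (card (jobs I))" by simp
    have "0 \<le> opt_flow_time I"
      unfolding opt_flow_time_def
      using offline_schedules_nonempty[OF I] total_flow_time_nonneg[OF I]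
      by (intro cInf_greatest) (auto simp: offline_schedules_def)
    moreover have "(real m)\<^sup>2 \<le> ((1 + \<epsilon>) / \<epsilon>)\<^sup>2" using m by (intro power_mono) auto
    ultimately have "2 * (real m)\<^sup>2 * opt_flow_time I \<le> 2 * ((1 + \<epsilon>) / \<epsilon>)\<^sup>2 * opt_flow_time I"
      by (intro mult_right_mono mult_left_mono) auto
    with plan_competitive[OF I m(1)]
    show "total_flow_time I (plan m I) \<le> 2 * ((1 + \<epsilon>) / \<epsilon>)\<^sup>2 * opt_flow_time I"
      by (rule order_trans)
  qed
qed

end
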